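(* Let $\mathbf{IrrDLat}$ be the category whose objects are the irreducibly generated distributive lattices and whose arrows $\mathcal{D}\to\mathcal{D}'$ are the distributive lattice homomorphisms $f$ such that the frame homomorphism $A(f):\mathrm{Idl}(\mathcal{D})\to\mathrm{Idl}(\mathcal{D}')$, sending an ideal $I$ of $\mathcal{D}$ to the ideal of $\mathcal{D}'$ generated by $f(I)$, preserves arbitrary infima. Let $\mathbf{Pos}_{comp}$ be the category whose objects are the posets $\mathcal{P}$ such that for any $a,b\in\mathcal{P}$ there exists a finite set $\{c_k\mid k\in K\}$ of elements of $\mathcal{P}$ such that for any $p\in\mathcal{P}$, $p\leq a$ and $p\leq b$ if and only if $p\leq c_k$ for some $k\in K$, and whose arrows $\mathcal{P}\to\mathcal{P}'$ are the monotone maps $g:\mathcal{P}\to\mathcal{P}'$ such that $g^{-1}:\mathrm{Id}(\mathcal{P}')\to\mathrm{Id}(\mathcal{P})$ sends ideals in $\mathrm{Id}_{comp}(\mathcal{P}')$ to ideals in $\mathrm{Id}_{comp}(\mathcal{P})$ (equivalently, for any $q\in\mathcal{P}'$ there exists a finite family $\{a_k\mid k\in K\}$ of elements of $\mathcal{P}$ such that for any $p\in\mathcal{P}$, $g(p)\leq q$ if and only if $p\leq a_k$ for some $k\in K$). Let $D:\mathbf{IrrDLat}^{\mathrm{op}}\to\mathbf{Pos}_{comp}$ be the functor sending $\mathcal{D}$ to the poset $\mathrm{Irr}(\mathcal{D})$ of its join-irreducible elements and $f:\mathcal{D}\to\mathcal{D}'$ to the restriction $\mathrm{Irr}(\mathcal{D}')\to\mathrm{Irr}(\mathcal{D})$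 of the left adjoint to $A(f)$ to the sets of join-irreducible elements of $\mathcal{D}'$ and of $\mathcal{D}$ (elements being identified with the principal ideals they generate). Let $E:\mathbf{Pos}_{comp}\to\mathbf{IrrDLat}^{\mathrm{op}}$ be the functor sending $\mathcal{P}$ to $\mathrm{Id}_{comp}(\mathcal{P})$ and $g:\mathcal{P}\to\mathcal{P}'$ to the restriction $\mathrm{Id}_{comp}(\mathcal{P}')\to\mathrm{Id}_{comp}(\mathcal{P})$ of $g^{-1}$. Then, via the functors $D$ and $E$, the categories $\mathbf{IrrDLat}$ and $\mathbf{Pos}_{comp}$ are dual to each other.
   Context: Distributive lattice homomorphisms are maps preserving finite meets and finite joins. An element $d$ of a distributive lattice $\mathcal{D}$ is join-irreducible if for any $a,b\in\mathcal{D}$, $a\vee b=d$ implies $a=d$ or $b=d$. A distributive lattice is irreducibly generated if every element of it can be expressed as a finite join of join-irreducible elements. $\mathrm{Idl}(\mathcal{D})$ is the frame of ideals of $\mathcal{D}$ (lower sets closed under finite joins), ordered by inclusion. For a poset $\mathcal{P}$, $\mathrm{Id}(\mathcal{P})$ is the frame of ideals of $\mathcal{P}$, i.e. of lower sets of $\mathcal{P}$, ordered by inclusion, and $\mathrm{Id}_{comp}(\mathcal{P})$ is the poset of its compact elements, i.e. of the finite unions of principal ideals $\{q\mid q\le p\}$.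
   Formalization: Join-irreducible elements are required to differ from the bottom (else {0,1} is a counterexample). Two versions are proved: lattices not required to have a top, with the posets as stated; and lattices with top, with posets that are finite unions of principal ideals (an infinite antichain is not). *)

theory Defs
  imports "HOL-Algebra.Galois_Connection" "HOL-Library.Infinite_Typeclass" "HOL-Library.Equipollence"
begin

section \<open>Categories, functors and equivalences\<close>

text \<open>Categories are given by hom-sets indexed by pairs of objects (which need not be disjoint);
  \<open>Cmp C X Y Z g f\<close> is the composite of \<open>f : X \<rightarrow> Y\<close> and \<open>g : Y \<rightarrow> Z\<close>.\<close>

record ('o, 'm) cat =
  Ob :: "'o set"
  Hom :: "'o \<Rightarrow> 'o \<Rightarrow> 'm set"
  Idn :: "'o \<Rightarrow> 'm"
  Cmp :: "'o \<Rightarrow> 'o \<Rightarrow> 'o \<Rightarrow> 'm \<Rightarrow> 'm \<Rightarrow> 'm"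

locale category =
  fixes C :: "('o, 'm) cat"
  assumes Idn_in_Hom: "X \<in> Ob C \<Longrightarrow> Idn C X \<in> Hom C X X"
    and Cmp_in_Hom: "\<lbrakk>X \<in> Ob C; Y \<in> Ob C; Z \<in> Ob C; f \<in> Hom C X Y; g \<in> Hom C Y Z\<rbrakk>
          \<Longrightarrow> Cmp C X Y Z g f \<in> Hom C X Z"
    and Cmp_Idn_left: "\<lbrakk>X \<in> Ob C; Y \<in> Ob C; f \<in> Hom C X Y\<rbrakk> \<Longrightarrow> Cmp C X Y Y (Idn C Y) f = f"
    and Cmp_Idn_right: "\<lbrakk>X \<in> Ob C; Y \<in> Ob C; f \<in> Hom C X Y\<rbrakk> \<Longrightarrow> Cmp C X X Y f (Idn C X) = f"
    and Cmp_assoc: "\<lbrakk>W \<in> Ob C; X \<in> Ob C; Y \<in> Ob C; Z \<in> Ob C;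
            f \<in> Hom C W X; g \<in> Hom C X Y; h \<in> Hom C Y Z\<rbrakk>
          \<Longrightarrow> Cmp C W Y Z h (Cmp C W X Y g f) = Cmp C W X Z (Cmp C X Y Z h g) f"

definition opposite :: "('o, 'm) cat \<Rightarrow> ('o, 'm) cat" where
  "opposite C = \<lparr>Ob = Ob C, Hom = (\<lambda>X Y. Hom C Y X), Idn = Idn C,
                 Cmp = (\<lambda>X Y Z g f. Cmp C Z Y X f g)\<rparr>"

definition full_subcategory :: "('o, 'm) cat \<Rightarrow> ('o \<Rightarrow> bool) \<Rightarrow> ('o, 'm) cat" where
  "full_subcategory C P = C\<lparr>Ob := {X \<in> Ob C. P X}\<rparr>"

record ('o1, 'm1, 'o2, 'm2) fctr =
  Fob :: "'o1 \<Rightarrow> 'o2"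
  Fmap :: "'o1 \<Rightarrow> 'o1 \<Rightarrow> 'm1 \<Rightarrow> 'm2"

locale is_functor =
  fixes C :: "('o1, 'm1) cat" and D :: "('o2, 'm2) cat" and F :: "('o1, 'm1, 'o2, 'm2) fctr"
  assumes Fob_in_Ob: "X \<in> Ob C \<Longrightarrow> Fob F X \<in> Ob D"
    and Fmap_in_Hom: "\<lbrakk>X \<in> Ob C; Y \<in> Ob C; f \<in> Hom C X Y\<rbrakk>
          \<Longrightarrow> Fmap F X Y f \<in> Hom D (Fob F X) (Fob F Y)"
    and Fmap_Idn: "X \<in> Ob C \<Longrightarrow> Fmap F X X (Idn C X) = Idn D (Fob F X)"
    and Fmap_Cmp: "\<lbrakk>X \<in> Ob C; Y \<in> Ob C; Z \<in> Ob C; f \<in> Hom C X Y; g \<in> Hom C Y Z\<rbrakk>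
          \<Longrightarrow> Fmap F X Z (Cmp C X Y Z g f)
              = Cmp D (Fob F X) (Fob F Y) (Fob F Z) (Fmap F Y Z g) (Fmap F X Y f)"

definition identity_functor :: "('o, 'm, 'o, 'm) fctr" where
  "identity_functor = \<lparr>Fob = (\<lambda>X. X), Fmap = (\<lambda>X Y f. f)\<rparr>"

definition compose_functors ::
    "('o2, 'm2, 'o3, 'm3) fctr \<Rightarrow> ('o1, 'm1, 'o2, 'm2) fctr \<Rightarrow> ('o1, 'm1, 'o3, 'm3) fctr" where
  "compose_functors G F = \<lparr>Fob = (\<lambda>X. Fob G (Fob F X)),
                           Fmap = (\<lambda>X Y f. Fmap G (Fob F X) (Fob F Y) (Fmap F X Y f))\<rparr>"

definition isomorphism :: "('o, 'm) cat \<Rightarrow> 'o \<Rightarrow> 'o \<Rightarrow> 'm \<Rightarrow> bool" where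
  "isomorphism C X Y f \<longleftrightarrow>
     f \<in> Hom C X Y \<and> (\<exists>g \<in> Hom C Y X. Cmp C X Y X g f = Idn C X \<and> Cmp C Y X Y f g = Idn C Y)"

definition naturally_isomorphic ::
    "('o1, 'm1) cat \<Rightarrow> ('o2, 'm2) cat \<Rightarrow> ('o1, 'm1, 'o2, 'm2) fctr \<Rightarrow> ('o1, 'm1, 'o2, 'm2) fctr
      \<Rightarrow> bool" where
  "naturally_isomorphic C D F G \<longleftrightarrow>
     (\<exists>\<tau>. (\<forall>X \<in> Ob C. isomorphism D (Fob F X) (Fob G X) (\<tau> X)) \<and>
          (\<forall>X \<in> Ob C. \<forall>Y \<in> Ob C. \<forall>f \<in> Hom C X Y.
             Cmp D (Fob F X) (Fob F Y) (Fob G Y) (\<tau> Y) (Fmap F X Y f)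
             = Cmp D (Fob F X) (Fob G X) (Fob G Y) (Fmap G X Y f) (\<tau> X)))"

definition equivalence_via ::
    "('o1, 'm1) cat \<Rightarrow> ('o2, 'm2) cat \<Rightarrow> ('o1, 'm1, 'o2, 'm2) fctr \<Rightarrow> ('o2, 'm2, 'o1, 'm1) fctr
      \<Rightarrow> bool" where
  "equivalence_via C D F G \<longleftrightarrow>
     category C \<and> category D \<and> is_functor C D F \<and> is_functor D C G \<and>
     naturally_isomorphic C C (compose_functors G F) identity_functor \<and>
     naturally_isomorphic D D (compose_functors F G) identity_functor"

definition dual_via ::
    "('o1, 'm1) cat \<Rightarrow> ('o2, 'm2) cat \<Rightarrow> ('o1, 'm1, 'o2, 'm2) fctr \<Rightarrow> ('o2, 'm2, 'o1, 'm1) fctr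
      \<Rightarrow> bool" where
  "dual_via C D F G \<longleftrightarrow> category C \<and> equivalence_via (opposite C) D F G"


section \<open>Orders and lattices\<close>

definition inclusion_order :: "'a set set \<Rightarrow> 'a set gorder" where
  "inclusion_order S = \<lparr>carrier = S, eq = (=), le = (\<subseteq>)\<rparr>"

definition lower_set :: "'a gorder \<Rightarrow> 'a set \<Rightarrow> bool" where
  "lower_set P U \<longleftrightarrow>
     U \<subseteq> carrier P \<and> (\<forall>x \<in> U. \<forall>y \<in> carrier P. y \<sqsubseteq>\<^bsub>P\<^esub> x \<longrightarrow> y \<in> U)"

definition principal :: "'a gorder \<Rightarrow> 'a \<Rightarrow> 'a set" where
  "principal P p = {q \<in> carrier P. q \<sqsubseteq>\<^bsub>P\<^esub> p}"

definition preserves_sup :: "'a gorder \<Rightarrow> 'b gorder \<Rightarrow> ('a \<Rightarrow> 'b) \<Rightarrow> 'a set \<Rightarrow> bool" where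
  "preserves_sup L M f X \<longleftrightarrow>
     (\<forall>s. least L s (Upper L X) \<longrightarrow> least M (f s) (Upper M (f ` X)))"

definition preserves_inf :: "'a gorder \<Rightarrow> 'b gorder \<Rightarrow> ('a \<Rightarrow> 'b) \<Rightarrow> 'a set \<Rightarrow> bool" where
  "preserves_inf L M f X \<longleftrightarrow>
     (\<forall>s. greatest L s (Lower L X) \<longrightarrow> greatest M (f s) (Lower M (f ` X)))"

text \<open>A distributive lattice has all finite joins, the empty join \<open>\<bottom>\<close> included, and all
  nonempty finite meets. A top element is not required: an infinite antichain \<open>P\<close> satisfies the
  condition on the objects of \<open>Pos_comp\<close> below, but its compact ideals are its finite subsets, and
  none of these is the largest. Lattices with a top element are singled out by \<open>has_top\<close>.\<close>

locale distributive_lattice = lattice L + weak_partial_order_bottom L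
  for L :: "'a gorder" (structure) +
  assumes meet_join_distrib:
    "\<lbrakk>x \<in> carrier L; y \<in> carrier L; z \<in> carrier L\<rbrakk> \<Longrightarrow> x \<sqinter> (y \<squnion> z) = (x \<sqinter> y) \<squnion> (x \<sqinter> z)"

definition has_top :: "'a gorder \<Rightarrow> bool" where
  "has_top L \<longleftrightarrow> (\<exists>t. greatest L t (carrier L))"

text \<open>Maps are kept extensional, so that arrows are equal iff they agree on the source. Since \<open>X\<close>
  may be empty, \<open>\<bottom>\<close> is preserved, and so is the top element of \<open>L\<close> whenever \<open>L\<close> has one.\<close>

definition dlat_hom :: "'a gorder \<Rightarrow> 'b gorder \<Rightarrow> ('a \<Rightarrow> 'b) set" where
  "dlat_hom L M = {f \<in> carrier L \<rightarrow>\<^sub>E carrier M.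
     \<forall>X. finite X \<and> X \<subseteq> carrier L \<longrightarrow> preserves_sup L M f X \<and> preserves_inf L M f X}"

text \<open>The condition \<open>d \<noteq> \<bottom>\<close> is the case of the empty join in the usual definition of
  join-irreducibility; without it \<open>\<bottom>\<close> would count as join-irreducible.\<close>

definition Irr :: "'a gorder \<Rightarrow> 'a set" where
  "Irr L = {d \<in> carrier L. d \<noteq> \<bottom>\<^bsub>L\<^esub> \<and>
     (\<forall>a \<in> carrier L. \<forall>b \<in> carrier L. a \<squnion>\<^bsub>L\<^esub> b = d \<longrightarrow> a = d \<or> b = d)}"

definition irreducibly_generated :: "'a gorder \<Rightarrow> bool" where
  "irreducibly_generated L \<longleftrightarrow>
     (\<forall>x \<in> carrier L. \<exists>A. finite A \<and> A \<subseteq> Irr L \<and> x = \<Squnion>\<^bsub>L\<^esub>A)"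

definition lattice_ideal :: "'a gorder \<Rightarrow> 'a set \<Rightarrow> bool" where
  "lattice_ideal L I \<longleftrightarrow> lower_set L I \<and> (\<forall>A. finite A \<and> A \<subseteq> I \<longrightarrow> \<Squnion>\<^bsub>L\<^esub>A \<in> I)"

definition Idl :: "'a gorder \<Rightarrow> 'a set gorder" where
  "Idl L = inclusion_order {I. lattice_ideal L I}"

definition generated_ideal :: "'a gorder \<Rightarrow> 'a set \<Rightarrow> 'a set" where
  "generated_ideal L S = \<Inter>{I. lattice_ideal L I \<and> S \<subseteq> I}"

definition ideal_map :: "'b gorder \<Rightarrow> ('a \<Rightarrow> 'b) \<Rightarrow> 'a set \<Rightarrow> 'b set" where
  "ideal_map M f I = generated_ideal M (f ` I)"

text \<open>The left adjoint \<open>M \<rightarrow> L\<close> of \<open>u : L \<rightarrow> M\<close>; by antisymmetry there is at most one.\<close>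

definition left_adjoint :: "'a gorder \<Rightarrow> 'b gorder \<Rightarrow> ('a \<Rightarrow> 'b) \<Rightarrow> 'b \<Rightarrow> 'a" where
  "left_adjoint L M u = (THE l. l \<in> carrier M \<rightarrow>\<^sub>E carrier L \<and>
     galois_connection \<lparr>orderA = M, orderB = L, lower = l, upper = u\<rparr>)"


section \<open>Lower sets of a poset and compact elements\<close>

definition Id_frame :: "'a gorder \<Rightarrow> 'a set gorder" where
  "Id_frame P = inclusion_order {U. lower_set P U}"

definition compact_element :: "'a gorder \<Rightarrow> 'a \<Rightarrow> bool" where
  "compact_element L k \<longleftrightarrow> k \<in> carrier L \<and>
     (\<forall>X \<subseteq> carrier L. k \<sqsubseteq>\<^bsub>L\<^esub> \<Squnion>\<^bsub>L\<^esub>X \<longrightarrow> (\<exists>Y \<subseteq> X. finite Y \<and> k \<sqsubseteq>\<^bsub>L\<^esub> \<Squnion>\<^bsub>L\<^esub>Y))"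

definition Id_comp :: "'a gorder \<Rightarrow> 'a set gorder" where
  "Id_comp P = inclusion_order {U. compact_element (Id_frame P) U}"

definition preimage :: "'a gorder \<Rightarrow> ('a \<Rightarrow> 'b) \<Rightarrow> 'b set \<Rightarrow> 'a set" where
  "preimage P g U = {p \<in> carrier P. g p \<in> U}"


section \<open>The two categories\<close>

text \<open>The type \<open>'u\<close> plays the role of the universe: objects are carried by subsets of \<open>'u\<close>.\<close>

definition IrrDLat :: "('u gorder, 'u \<Rightarrow> 'u) cat" where
  "IrrDLat = \<lparr>
     Ob = {L. distributive_lattice L \<and> irreducibly_generated L},
     Hom = (\<lambda>L M. {f \<in> dlat_hom L M.
              \<forall>X \<subseteq> carrier (Idl L). preserves_inf (Idl L) (Idl M) (ideal_map M f) X}),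
     Idn = (\<lambda>L. restrict (\<lambda>x. x) (carrier L)),
     Cmp = (\<lambda>L M N g f. compose (carrier L) g f)\<rparr>"

definition Pos_comp :: "('u gorder, 'u \<Rightarrow> 'u) cat" where
  "Pos_comp = \<lparr>
     Ob = {P. partial_order P \<and>
              (\<forall>a \<in> carrier P. \<forall>b \<in> carrier P. \<exists>C. finite C \<and> C \<subseteq> carrier P \<and>
                 (\<forall>p \<in> carrier P. p \<sqsubseteq>\<^bsub>P\<^esub> a \<and> p \<sqsubseteq>\<^bsub>P\<^esub> b \<longleftrightarrow> (\<exists>c \<in> C. p \<sqsubseteq>\<^bsub>P\<^esub> c)))},
     Hom = (\<lambda>P Q. {g \<in> carrier P \<rightarrow>\<^sub>E carrier Q. isotone P Q g \<and>
              preimage P g ` carrier (Id_comp Q) \<subseteq> carrier (Id_comp P)}),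
     Idn = (\<lambda>P. restrict (\<lambda>x. x) (carrier P)),
     Cmp = (\<lambda>P Q R g f. compose (carrier P) g f)\<rparr>"

text \<open>The condition on \<open>P\<close> corresponding to a top element of \<open>Id_comp P\<close>: the case of the empty
  meet of the condition on objects of \<open>Pos_comp\<close>.\<close>

definition finitely_covered :: "'a gorder \<Rightarrow> bool" where
  "finitely_covered P \<longleftrightarrow>
     (\<exists>C. finite C \<and> C \<subseteq> carrier P \<and> (\<forall>p \<in> carrier P. \<exists>c \<in> C. p \<sqsubseteq>\<^bsub>P\<^esub> c))"


section \<open>The functor D\<close>

text \<open>For \<open>f : L \<rightarrow> M\<close> in \<open>IrrDLat\<close>. As \<open>D\<close> is defined on the opposite category, its arrow part gets
  the source \<open>M\<close> and the target \<open>L\<close> of \<open>f\<close> in the opposite category in this order.\<close>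

definition D_map :: "'a gorder \<Rightarrow> 'b gorder \<Rightarrow> ('a \<Rightarrow> 'b) \<Rightarrow> 'b \<Rightarrow> 'a" where
  "D_map L M f = (\<lambda>d' \<in> Irr M. THE d. d \<in> Irr L \<and>
     left_adjoint (Idl L) (Idl M) (ideal_map M f) (principal M d') = principal L d)"

definition D_functor :: "('u gorder, 'u \<Rightarrow> 'u, 'u gorder, 'u \<Rightarrow> 'u) fctr" where
  "D_functor = \<lparr>Fob = (\<lambda>L. L\<lparr>carrier := Irr L\<rparr>), Fmap = (\<lambda>M L f. D_map L M f)\<rparr>"


section \<open>The functor E\<close>

text \<open>\<open>Id_comp P\<close> lives on the type \<open>'u set\<close>. To obtain an object over the universe \<open>'u\<close>, it is
  replaced by its isomorphic copy along an injection \<open>ideal_code P\<close>, which exists when \<open>'u\<close> is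
  infinite (lemma \<open>inj_on_ideal_code\<close> below).\<close>

definition ideal_code :: "'u gorder \<Rightarrow> 'u set \<Rightarrow> 'u" where
  "ideal_code P = (SOME c. inj_on c (carrier (Id_comp P)))"

definition ideal_decode :: "'u gorder \<Rightarrow> 'u \<Rightarrow> 'u set" where
  "ideal_decode P = inv_into (carrier (Id_comp P)) (ideal_code P)"

definition E_ob :: "'u gorder \<Rightarrow> 'u gorder" where
  "E_ob P = \<lparr>carrier = ideal_code P ` carrier (Id_comp P), eq = (=),
             le = (\<lambda>x y. ideal_decode P x \<sqsubseteq>\<^bsub>Id_comp P\<^esub> ideal_decode P y)\<rparr>"

definition E_map :: "'u gorder \<Rightarrow> 'u gorder \<Rightarrow> ('u \<Rightarrow> 'u) \<Rightarrow> 'u \<Rightarrow> 'u" where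
  "E_map P Q g = (\<lambda>x \<in> carrier (E_ob Q). ideal_code P (preimage P g (ideal_decode Q x)))"

definition E_functor :: "('u gorder, 'u \<Rightarrow> 'u, 'u gorder, 'u \<Rightarrow> 'u) fctr" where
  "E_functor = \<lparr>Fob = E_ob, Fmap = E_map\<rparr>"


section \<open>Sanity checks\<close>

lemma lower_set_Union: "(\<And>U. U \<in> X \<Longrightarrow> lower_set P U) \<Longrightarrow> lower_set P (\<Union>X)"
  unfolding lower_set_def by blast

lemma Sup_Id_frame:
  assumes X: "X \<subseteq> carrier (Id_frame P)"
  shows "\<Squnion>\<^bsub>Id_frame P\<^esub>X = \<Union>X"
proof -
  have lu: "lower_set P (\<Union>X)"
    using X by (intro lower_set_Union) (auto simp: Id_frame_def inclusion_order_def)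
  have l: "least (Id_frame P) (\<Union>X) (Upper (Id_frame P) X)"
    using lu X by (auto simp: least_def Upper_def Id_frame_def inclusion_order_def)
  show ?thesis
    unfolding sup_def
  proof (rule some_equality[where P = "\<lambda>x. least (Id_frame P) x (Upper (Id_frame P) X)", OF l])
    fix x assume "least (Id_frame P) x (Upper (Id_frame P) X)"
    with l show "x = \<Union>X"
      unfolding least_def by (intro subset_antisym) (simp_all add: Id_frame_def inclusion_order_def)
  qed
qed

lemma lower_set_principal:
  assumes "partial_order P" "p \<in> carrier P"
  shows "lower_set P (principal P p)"
proof -
  interpret partial_order P by fact
  show ?thesis using assms(2) le_trans by (auto simp: lower_set_def principal_def)
qed

lemma carrier_Id_comp:
  assumes P: "partial_order P"
  shows "carrier (Id_comp P) = {U. \<exists>A. finite A \<and> A \<subseteq> carrier P \<and> U = (\<Union>a\<in>A. principal P a)}"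
proof -
  interpret partial_order P by fact
  have "compact_element (Id_frame P) U \<longleftrightarrow>
          (\<exists>A. finite A \<and> A \<subseteq> carrier P \<and> U = (\<Union>a\<in>A. principal P a))" (is "?l \<longleftrightarrow> ?r") for U
  proof
    assume k: ?l
    then have U: "lower_set P U"
      by (simp add: compact_element_def Id_frame_def inclusion_order_def)
    let ?X = "principal P ` U"
    have XC: "?X \<subseteq> carrier (Id_frame P)"
      using U lower_set_principal[OF P] unfolding lower_set_def[of P U]
      by (auto simp: Id_frame_def inclusion_order_def)
    have "U \<subseteq> \<Union>?X"
      using U le_refl unfolding lower_set_def principal_def by blast
    then have "U \<sqsubseteq>\<^bsub>Id_frame P\<^esub> \<Squnion>\<^bsub>Id_frame P\<^esub>?X"
      unfolding Sup_Id_frame[OF XC] by (simp add: Id_frame_def inclusion_order_def)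
    then obtain Y where Y: "Y \<subseteq> ?X" "finite Y" "U \<sqsubseteq>\<^bsub>Id_frame P\<^esub> \<Squnion>\<^bsub>Id_frame P\<^esub>Y"
      using k XC unfolding compact_element_def by blast
    have UY: "U \<subseteq> \<Union>Y"
      using Y(3) Sup_Id_frame[of Y P] XC Y(1) by (simp add: Id_frame_def inclusion_order_def)
    obtain A where A: "A \<subseteq> U" "finite A" "Y = principal P ` A"
      using finite_subset_image[OF Y(2) Y(1)] by blast
    have "(\<Union>a\<in>A. principal P a) \<subseteq> U"
      using U A(1) by (auto simp: lower_set_def principal_def)
    with UY A U show ?r
      by (intro exI[of _ A]) (auto simp: lower_set_def)
  next
    assume ?r
    then obtain A where A: "finite A" "A \<subseteq> carrier P" "U = (\<Union>a\<in>A. principal P a)" by blast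
    have lU: "lower_set P U"
      unfolding A(3) using A(2) lower_set_principal[OF P] by (intro lower_set_Union) auto
    have "\<exists>Y\<subseteq>X. finite Y \<and> U \<sqsubseteq>\<^bsub>Id_frame P\<^esub> \<Squnion>\<^bsub>Id_frame P\<^esub>Y"
      if X: "X \<subseteq> carrier (Id_frame P)" and le: "U \<sqsubseteq>\<^bsub>Id_frame P\<^esub> \<Squnion>\<^bsub>Id_frame P\<^esub>X" for X
    proof -
      have "U \<subseteq> \<Union>X"
        using le Sup_Id_frame[OF X] by (simp add: Id_frame_def inclusion_order_def)
      moreover have "A \<subseteq> U"
        using A(2,3) le_refl unfolding principal_def by blast
      ultimately have "\<forall>a\<in>A. \<exists>V. V \<in> X \<and> a \<in> V" by blast
      then obtain h where h: "\<And>a. a \<in> A \<Longrightarrow> h a \<in> X \<and> a \<in> h a" by metis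
      have hX: "h ` A \<subseteq> X" using h by blast
      have "U \<subseteq> \<Union>(h ` A)"
      proof
        fix x assume "x \<in> U"
        then obtain a where a: "a \<in> A" "x \<in> carrier P" "x \<sqsubseteq>\<^bsub>P\<^esub> a"
          using A(3) by (auto simp: principal_def)
        moreover have "lower_set P (h a)"
          using h[OF a(1)] X by (auto simp: Id_frame_def inclusion_order_def)
        ultimately have "x \<in> h a" using h[OF a(1)] by (auto simp: lower_set_def)
        with a(1) show "x \<in> \<Union>(h ` A)" by blast
      qed
      then have "U \<sqsubseteq>\<^bsub>Id_frame P\<^esub> \<Squnion>\<^bsub>Id_frame P\<^esub>(h ` A)"
        using Sup_Id_frame[of "h ` A" P] hX X by (simp add: Id_frame_def inclusion_order_def)
      then show ?thesis using hX A(1) by blast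
    qed
    then show ?l
      using lU by (simp add: compact_element_def) (simp add: Id_frame_def inclusion_order_def)
  qed
  then show ?thesis by (simp add: Id_comp_def inclusion_order_def)
qed

text \<open>The elementwise description of the arrows of \<open>Pos_comp\<close>.\<close>

lemma preimage_Id_comp_iff:
  assumes P: "partial_order P" and Q: "partial_order Q" and g: "g \<in> carrier P \<rightarrow> carrier Q"
  shows "preimage P g ` carrier (Id_comp Q) \<subseteq> carrier (Id_comp P) \<longleftrightarrow>
    (\<forall>q \<in> carrier Q. \<exists>A. finite A \<and> A \<subseteq> carrier P \<and>
       (\<forall>p \<in> carrier P. g p \<sqsubseteq>\<^bsub>Q\<^esub> q \<longleftrightarrow> (\<exists>a \<in> A. p \<sqsubseteq>\<^bsub>P\<^esub> a)))" (is "?l \<longleftrightarrow> ?r")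
proof
  assume l: ?l
  show ?r
  proof
    fix q assume q: "q \<in> carrier Q"
    have "principal Q q \<in> carrier (Id_comp Q)"
      unfolding carrier_Id_comp[OF Q] using q by (intro CollectI exI[of _ "{q}"]) auto
    with l have "preimage P g (principal Q q) \<in> carrier (Id_comp P)" by blast
    then obtain A where A: "finite A" "A \<subseteq> carrier P"
        "preimage P g (principal Q q) = (\<Union>a\<in>A. principal P a)"
      unfolding carrier_Id_comp[OF P] by blast
    have "g p \<sqsubseteq>\<^bsub>Q\<^esub> q \<longleftrightarrow> (\<exists>a \<in> A. p \<sqsubseteq>\<^bsub>P\<^esub> a)" if p: "p \<in> carrier P" for p
    proof -
      have "g p \<sqsubseteq>\<^bsub>Q\<^esub> q \<longleftrightarrow> p \<in> preimage P g (principal Q q)"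
        using p g by (auto simp: preimage_def principal_def)
      also have "\<dots> \<longleftrightarrow> (\<exists>a \<in> A. p \<sqsubseteq>\<^bsub>P\<^esub> a)"
        unfolding A(3) using p by (auto simp: principal_def)
      finally show ?thesis .
    qed
    with A show "\<exists>A. finite A \<and> A \<subseteq> carrier P \<and>
       (\<forall>p \<in> carrier P. g p \<sqsubseteq>\<^bsub>Q\<^esub> q \<longleftrightarrow> (\<exists>a \<in> A. p \<sqsubseteq>\<^bsub>P\<^esub> a))"
      by (intro exI[of _ A]) simp
  qed
next
  assume ?r
  from bchoice[OF this] obtain h where h: "\<forall>q \<in> carrier Q. finite (h q) \<and> h q \<subseteq> carrier P \<and>
       (\<forall>p \<in> carrier P. g p \<sqsubseteq>\<^bsub>Q\<^esub> q \<longleftrightarrow> (\<exists>a \<in> h q. p \<sqsubseteq>\<^bsub>P\<^esub> a))" by (rule exE)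
  show ?l
  proof clarify
    fix U assume "U \<in> carrier (Id_comp Q)"
    then obtain B where B: "finite B" "B \<subseteq> carrier Q" "U = (\<Union>b\<in>B. principal Q b)"
      unfolding carrier_Id_comp[OF Q] by blast
    have hB: "\<And>b. b \<in> B \<Longrightarrow> finite (h b) \<and> h b \<subseteq> carrier P \<and>
       (\<forall>p \<in> carrier P. g p \<sqsubseteq>\<^bsub>Q\<^esub> b \<longleftrightarrow> (\<exists>a \<in> h b. p \<sqsubseteq>\<^bsub>P\<^esub> a))"
      using bspec[OF h] B(2) subsetD by metis
    have "preimage P g U = {p \<in> carrier P. \<exists>b\<in>B. g p \<sqsubseteq>\<^bsub>Q\<^esub> b}"
      unfolding B(3) preimage_def principal_def using g by auto
    also have "\<dots> = {p \<in> carrier P. \<exists>b\<in>B. \<exists>a\<in>h b. p \<sqsubseteq>\<^bsub>P\<^esub> a}"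
      using hB by (intro Collect_cong conj_cong bex_cong) simp_all
    also have "\<dots> = (\<Union>a\<in>(\<Union>b\<in>B. h b). principal P a)"
      by (auto simp: principal_def)
    finally have "preimage P g U = (\<Union>a\<in>(\<Union>b\<in>B. h b). principal P a)" .
    moreover have "finite (\<Union>b\<in>B. h b)" "(\<Union>b\<in>B. h b) \<subseteq> carrier P"
      using B(1) hB by auto
    ultimately show "preimage P g U \<in> carrier (Id_comp P)"
      unfolding carrier_Id_comp[OF P] by (intro CollectI exI[of _ "\<Union>b\<in>B. h b"]) simp
  qed
qed

lemma finite_subsets_lepoll:
  includes cardinal_syntax
  assumes inf: "infinite (UNIV :: 'u set)"
  shows "{A :: 'u set. finite A} \<lesssim> (UNIV :: 'u set)"
proof -
  let ?F = "\<lambda>n. {A :: 'u set. finite A \<and> card A = n}"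
  have le: "|?F n| \<le>o |UNIV :: 'u set|" for n
  proof (induction n)
    case 0
    have "?F 0 = {{}}" by auto
    then show ?case by (simp add: inj_on_def flip: card_of_ordLeq)
  next
    case (Suc n)
    have "?F (Suc n) \<subseteq> (\<lambda>(a, A). insert a A) ` (UNIV \<times> ?F n)"
    proof
      fix A :: "'u set" assume "A \<in> ?F (Suc n)"
      then obtain a B where "A = insert a B" "finite B" "card B = n"
        by (metis (mono_tags, lifting) card_Suc_eq_finite mem_Collect_eq)
      then show "A \<in> (\<lambda>(a, A). insert a A) ` (UNIV \<times> ?F n)" by force
    qed
    then have "|?F (Suc n)| \<le>o |(UNIV :: 'u set) \<times> ?F n|"
      by (meson card_of_image card_of_mono1 ordLeq_transitive)
    moreover have "|(UNIV :: 'u set) \<times> ?F n| \<le>o |UNIV :: 'u set|"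
      by (rule card_of_Sigma_ordLeq_infinite[OF inf]) (auto simp: Suc.IH card_of_refl ordIso_imp_ordLeq)
    ultimately show ?case by (rule ordLeq_transitive)
  qed
  have "|UNIV :: nat set| \<le>o |UNIV :: 'u set|"
    using inf infinite_iff_card_of_nat by blast
  then have "|\<Union>n\<in>UNIV. ?F n| \<le>o |UNIV :: 'u set|"
    using le by (intro card_of_UNION_ordLeq_infinite[OF inf]) auto
  moreover have "(\<Union>n\<in>UNIV. ?F n) = {A. finite A}" by auto
  ultimately have "|{A :: 'u set. finite A}| \<le>o |UNIV :: 'u set|" by simp
  then show ?thesis by (simp add: lepoll_def flip: card_of_ordLeq)
qed

lemma inj_on_ideal_code:
  fixes P :: "'u::infinite gorder"
  assumes P: "partial_order P"
  shows "inj_on (ideal_code P) (carrier (Id_comp P))"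
proof -
  have "carrier (Id_comp P) \<lesssim> {A :: 'u set. finite A}"
    unfolding carrier_Id_comp[OF P]
    by (rule lepoll_trans[OF subset_imp_lepoll image_lepoll[of "\<lambda>A. \<Union>a\<in>A. principal P a"]]) auto
  then have "carrier (Id_comp P) \<lesssim> (UNIV :: 'u set)"
    using finite_subsets_lepoll[OF infinite_UNIV] lepoll_trans by blast
  then have "\<exists>c :: 'u set \<Rightarrow> 'u. inj_on c (carrier (Id_comp P))"
    by (auto simp: lepoll_def)
  then show ?thesis unfolding ideal_code_def by (rule someI_ex)
qed

end

theory Submission
  imports Defs
begin

text \<open>
  In a distributive lattice a join-irreducible element \<open>d\<close> is join-prime: if it is below a finite join,
  it is below one of the joinands. In an irreducibly generated lattice \<open>L\<close> an element is therefore the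
  same thing as a lower set of irreducibles generated by finitely many of them, that is, as a compact
  element of the frame of lower sets of \<open>Irr L\<close>. Conversely, in the lattice of compact lower sets of a
  poset the irreducibles are exactly the principal lower sets. So \<open>D\<close> and \<open>E\<close> are inverse to each
  other on objects up to isomorphism; the condition on the objects of \<open>Pos_comp\<close> is what makes compact
  lower sets closed under binary intersection.

  On arrows, everything reduces to one adjunction. For a homomorphism \<open>f : L \<rightarrow> M\<close>, the map \<open>A(f)\<close>
  preserves all infima iff for each irreducible \<open>d\<close> of \<open>M\<close> there is a least \<open>a\<close> in \<open>L\<close> with
  \<open>d \<sqsubseteq> f a\<close> (\<open>ideal_map_preserves_inf_imp_adjoint\<close>, \<open>adjoint_imp_ideal_map_preserves_inf\<close>); this \<open>a\<close>
  is then irreducible, and it is \<open>D(f)(d)\<close>. Thus \<open>D(f)\<close> is characterized by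
  \<open>D(f)(d) \<sqsubseteq> x \<longleftrightarrow> d \<sqsubseteq> f x\<close> (\<open>D_map_adjoint\<close>), with no further mention of ideals. Functoriality of
  \<open>D\<close> is the composition of adjoints. For \<open>g : P \<rightarrow> Q\<close> the principal lower set of \<open>p\<close> is contained in
  \<open>g\<^sup>-\<^sup>1(U)\<close> iff \<open>g p \<in> U\<close>, so that \<open>E(g)\<close> has the adjoint \<open>g\<close> on irreducibles; this shows both that
  \<open>E(g)\<close> is an arrow and that \<open>D(E(g))\<close> is a copy of \<open>g\<close>. Naturality of \<open>L \<cong> E(D(L))\<close> is the adjunction again.

  Finally, a lattice \<open>L\<close> with a top element corresponds to a poset covered by finitely many principal
  lower sets, so the duality restricts to the two full subcategories.
\<close>


section \<open>Dualities and full subcategories\<close>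

lemma category_opposite: "category C \<Longrightarrow> category (opposite C)"
  unfolding category_def opposite_def by simp

lemma isomorphism_opposite: "isomorphism (opposite C) X Y f \<longleftrightarrow> isomorphism C Y X f"
  unfolding isomorphism_def opposite_def by auto

lemma category_full_subcategory: "category C \<Longrightarrow> category (full_subcategory C P)"
  unfolding category_def full_subcategory_def by simp

lemma opposite_full_subcategory:
  "opposite (full_subcategory C P) = full_subcategory (opposite C) P"
  unfolding opposite_def full_subcategory_def by simp

lemma is_functor_full_subcategory:
  assumes "is_functor C D F" and "\<And>X. X \<in> Ob C \<Longrightarrow> P X \<Longrightarrow> Q (Fob F X)"
  shows "is_functor (full_subcategory C P) (full_subcategory D Q) F"
  using assms unfolding is_functor_def full_subcategory_def by simp

lemma naturally_isomorphic_full_subcategory: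
  assumes "naturally_isomorphic C D F G"
  shows "naturally_isomorphic (full_subcategory C P) (full_subcategory D Q) F G"
  using assms unfolding naturally_isomorphic_def full_subcategory_def isomorphism_def
  by simp blast

text \<open>A full subcategory keeps all the arrows between its objects, among them the components of the
  natural isomorphisms and their inverses; so only the objects need attention.\<close>

lemma dual_via_full_subcategory:
  assumes "dual_via C D F G"
    and "\<And>X. X \<in> Ob C \<Longrightarrow> P X \<Longrightarrow> Q (Fob F X)"
    and "\<And>Y. Y \<in> Ob D \<Longrightarrow> Q Y \<Longrightarrow> P (Fob G Y)"
  shows "dual_via (full_subcategory C P) (full_subcategory D Q) F G"
proof -
  have "Ob (opposite C) = Ob C" by (simp add: opposite_def)
  then show ?thesis
    using assms unfolding dual_via_def equivalence_via_def opposite_full_subcategory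
    by (auto intro!: category_full_subcategory is_functor_full_subcategory
        naturally_isomorphic_full_subcategory)
qed


section \<open>Order isomorphisms\<close>

definition order_isomorphism :: "'a gorder \<Rightarrow> 'b gorder \<Rightarrow> ('a \<Rightarrow> 'b) \<Rightarrow> bool" where
  "order_isomorphism L M h \<longleftrightarrow> bij_betw h (carrier L) (carrier M) \<and>
     (\<forall>x \<in> carrier L. \<forall>y \<in> carrier L. h x \<sqsubseteq>\<^bsub>M\<^esub> h y \<longleftrightarrow> x \<sqsubseteq>\<^bsub>L\<^esub> y)"

lemma order_isomorphism_inverse:
  assumes h: "order_isomorphism L M h"
  shows "order_isomorphism M L (restrict (inv_into (carrier L) h) (carrier M))"
proof -
  have b: "bij_betw h (carrier L) (carrier M)"
    using h by (simp add: order_isomorphism_def)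
  have "inv_into (carrier L) h u \<in> carrier L" "h (inv_into (carrier L) h u) = u"
    if "u \<in> carrier M" for u
    using b that by (auto simp: bij_betw_def inv_into_into f_inv_into_f)
  then have "inv_into (carrier L) h u \<sqsubseteq>\<^bsub>L\<^esub> inv_into (carrier L) h v \<longleftrightarrow> u \<sqsubseteq>\<^bsub>M\<^esub> v"
    if "u \<in> carrier M" "v \<in> carrier M" for u v
    using h that unfolding order_isomorphism_def by metis
  moreover have "bij_betw (restrict (inv_into (carrier L) h) (carrier M)) (carrier M) (carrier L)"
    using bij_betw_inv_into[OF b] by (simp cong: bij_betw_cong)
  ultimately show ?thesis by (simp add: order_isomorphism_def)
qed

lemma order_isomorphism_compose_inverse:
  assumes h: "order_isomorphism L M h" and ext: "h \<in> extensional (carrier L)"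
  shows "compose (carrier L) (restrict (inv_into (carrier L) h) (carrier M)) h
           = restrict (\<lambda>x. x) (carrier L)"
    and "compose (carrier M) h (restrict (inv_into (carrier L) h) (carrier M))
           = restrict (\<lambda>x. x) (carrier M)"
  using h unfolding order_isomorphism_def bij_betw_def
  by (auto simp: compose_def f_inv_into_f intro!: restrict_ext)

lemma order_isomorphism_least_Upper:
  assumes h: "order_isomorphism L M h" and X: "X \<subseteq> carrier L"
    and s: "least L s (Upper L X)"
  shows "least M (h s) (Upper M (h ` X))"
proof -
  have M: "carrier M = h ` carrier L"
    and le: "\<And>x y. x \<in> carrier L \<Longrightarrow> y \<in> carrier L \<Longrightarrow> h x \<sqsubseteq>\<^bsub>M\<^esub> h y \<longleftrightarrow> x \<sqsubseteq>\<^bsub>L\<^esub> y"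
    using h by (auto simp: order_isomorphism_def bij_betw_def)
  have "s \<in> carrier L" "\<And>x. x \<in> X \<Longrightarrow> x \<sqsubseteq>\<^bsub>L\<^esub> s"
    "\<And>u. u \<in> carrier L \<Longrightarrow> (\<And>x. x \<in> X \<Longrightarrow> x \<sqsubseteq>\<^bsub>L\<^esub> u) \<Longrightarrow> s \<sqsubseteq>\<^bsub>L\<^esub> u"
    using s X by (auto simp: least_def Upper_def)
  then show ?thesis
    using X by (intro least_UpperI) (fastforce simp: M Upper_def le)+
qed

lemma order_isomorphism_greatest_Lower:
  assumes h: "order_isomorphism L M h" and X: "X \<subseteq> carrier L"
    and s: "greatest L s (Lower L X)"
  shows "greatest M (h s) (Lower M (h ` X))"
proof -
  have M: "carrier M = h ` carrier L"
    and le: "\<And>x y. x \<in> carrier L \<Longrightarrow> y \<in> carrier L \<Longrightarrow> h x \<sqsubseteq>\<^bsub>M\<^esub> h y \<longleftrightarrow> x \<sqsubseteq>\<^bsub>L\<^esub> y"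
    using h by (auto simp: order_isomorphism_def bij_betw_def)
  have "s \<in> carrier L" "\<And>x. x \<in> X \<Longrightarrow> s \<sqsubseteq>\<^bsub>L\<^esub> x"
    "\<And>u. u \<in> carrier L \<Longrightarrow> (\<And>x. x \<in> X \<Longrightarrow> u \<sqsubseteq>\<^bsub>L\<^esub> x) \<Longrightarrow> u \<sqsubseteq>\<^bsub>L\<^esub> s"
    using s X by (auto simp: greatest_def Lower_def)
  then show ?thesis
    using X by (intro greatest_LowerI) (fastforce simp: M Lower_def le)+
qed


section \<open>Irreducibly generated distributive lattices\<close>

context distributive_lattice
begin

lemma sup_eqI: "least L s (Upper L A) \<Longrightarrow> \<Squnion>A = s"
  unfolding sup_def using least_unique by (metis (mono_tags) someI)

lemma sup_empty: "\<Squnion>{} = \<bottom>"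
  using bottom_least by (intro sup_eqI) simp

lemma least_finite_sup:
  assumes "finite A" "A \<subseteq> carrier L"
  shows "least L (\<Squnion>A) (Upper L A)"
proof (cases "A = {}")
  case True
  then show ?thesis using bottom_least by (simp add: sup_empty)
next
  case False
  then show ?thesis using assms finite_sup_least by simp
qed

lemma finite_sup_in_carrier: "finite A \<Longrightarrow> A \<subseteq> carrier L \<Longrightarrow> \<Squnion>A \<in> carrier L"
  using least_finite_sup least_closed by blast

lemma finite_sup_le_iff:
  assumes "finite A" "A \<subseteq> carrier L" "x \<in> carrier L"
  shows "\<Squnion>A \<sqsubseteq> x \<longleftrightarrow> (\<forall>a\<in>A. a \<sqsubseteq> x)"
proof -
  have A: "least L (\<Squnion>A) (Upper L A)" using assms least_finite_sup by blast
  show ?thesis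
  proof
    assume "\<Squnion>A \<sqsubseteq> x"
    then show "\<forall>a\<in>A. a \<sqsubseteq> x"
      using least_Upper_above[OF A _ assms(2)] le_trans A assms by (meson least_closed subset_iff)
  next
    assume "\<forall>a\<in>A. a \<sqsubseteq> x"
    then show "\<Squnion>A \<sqsubseteq> x"
      using assms by (intro least_le[OF A]) (auto simp: Upper_def)
  qed
qed

lemma le_finite_sup: "finite A \<Longrightarrow> A \<subseteq> carrier L \<Longrightarrow> a \<in> A \<Longrightarrow> a \<sqsubseteq> \<Squnion>A"
  using finite_sup_le_iff[of A "\<Squnion>A"] finite_sup_in_carrier[of A] by simp

lemma join_le_iff:
  "x \<in> carrier L \<Longrightarrow> y \<in> carrier L \<Longrightarrow> z \<in> carrier L \<Longrightarrow> x \<squnion> y \<sqsubseteq> z \<longleftrightarrow> x \<sqsubseteq> z \<and> y \<sqsubseteq> z"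
  using finite_sup_le_iff[of "{x, y}" z] by (simp add: join_def)

lemma le_meet_iff:
  "x \<in> carrier L \<Longrightarrow> y \<in> carrier L \<Longrightarrow> z \<in> carrier L \<Longrightarrow> z \<sqsubseteq> x \<sqinter> y \<longleftrightarrow> z \<sqsubseteq> x \<and> z \<sqsubseteq> y"
  by (meson le_trans meet_closed meet_le meet_left meet_right)

lemma Irr_subset_carrier: "Irr L \<subseteq> carrier L"
  by (auto simp: Irr_def)

lemma Irr_in_carrier: "d \<in> Irr L \<Longrightarrow> d \<in> carrier L"
  by (auto simp: Irr_def)

text \<open>If \<open>d \<sqsubseteq> a \<squnion> b\<close> then \<open>d = (d \<sqinter> a) \<squnion> (d \<sqinter> b)\<close> by distributivity, so that irreducibility
  puts \<open>d\<close> below \<open>a\<close> or below \<open>b\<close>.\<close>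

lemma Irr_le_join:
  assumes d: "d \<in> Irr L" and ab: "a \<in> carrier L" "b \<in> carrier L" and le: "d \<sqsubseteq> a \<squnion> b"
  shows "d \<sqsubseteq> a \<or> d \<sqsubseteq> b"
proof -
  have dc: "d \<in> carrier L" using d by (rule Irr_in_carrier)
  have "d = d \<sqinter> (a \<squnion> b)"
    using le_iff_join[of d "a \<squnion> b"] dc ab le by simp
  also have "\<dots> = (d \<sqinter> a) \<squnion> (d \<sqinter> b)"
    using dc ab by (rule meet_join_distrib)
  finally have "d \<sqinter> a = d \<or> d \<sqinter> b = d"
    using d dc ab unfolding Irr_def by auto
  then show ?thesis using dc ab by (metis le_iff_join)
qed

lemma Irr_le_finite_sup:
  assumes d: "d \<in> Irr L" and A: "finite A" "A \<subseteq> carrier L" and le: "d \<sqsubseteq> \<Squnion>A"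
  shows "\<exists>a\<in>A. d \<sqsubseteq> a"
  using A le
proof (induction A)
  case empty
  have "d = \<bottom>"
    using empty d Irr_in_carrier by (intro le_antisym) (auto simp: sup_empty)
  then show ?case using d by (simp add: Irr_def)
next
  case (insert a A)
  have c: "\<Squnion>A \<in> carrier L" "a \<in> carrier L" "d \<in> carrier L"
    using insert d by (auto simp: finite_sup_in_carrier Irr_in_carrier)
  have "\<Squnion>(insert a A) \<sqsubseteq> a \<squnion> \<Squnion>A"
    using insert c join_le_iff[of a "\<Squnion>A" "a \<squnion> \<Squnion>A"] finite_sup_le_iff[of A "a \<squnion> \<Squnion>A"]
    by (simp add: finite_sup_le_iff)
  then have "d \<sqsubseteq> a \<squnion> \<Squnion>A"
    using insert c by (meson finite.insertI finite_sup_in_carrier join_closed le_trans)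
  then have "d \<sqsubseteq> a \<or> d \<sqsubseteq> \<Squnion>A"
    using Irr_le_join d c by blast
  then show ?case using insert by auto
qed

lemma Irr_le_finite_sup_iff:
  assumes "d \<in> Irr L" "finite A" "A \<subseteq> carrier L"
  shows "d \<sqsubseteq> \<Squnion>A \<longleftrightarrow> (\<exists>a\<in>A. d \<sqsubseteq> a)"
proof
  assume "\<exists>a\<in>A. d \<sqsubseteq> a"
  then show "d \<sqsubseteq> \<Squnion>A"
    using assms le_finite_sup finite_sup_in_carrier Irr_in_carrier le_trans by (meson subset_iff)
qed (use assms Irr_le_finite_sup in blast)

end

locale irreducibly_generated_lattice = distributive_lattice +
  assumes irreducibly_generated: "irreducibly_generated L"
begin

lemma finite_sup_of_Irr:
  assumes "x \<in> carrier L"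
  obtains A where "finite A" "A \<subseteq> Irr L" "A \<subseteq> carrier L" "x = \<Squnion>A"
proof -
  obtain A where "finite A" "A \<subseteq> Irr L" "x = \<Squnion>A"
    using assms irreducibly_generated unfolding irreducibly_generated_def by meson
  with Irr_subset_carrier that[of A] show thesis by auto
qed

lemma le_iff_Irr:
  assumes x: "x \<in> carrier L" and y: "y \<in> carrier L"
  shows "x \<sqsubseteq> y \<longleftrightarrow> (\<forall>d\<in>Irr L. d \<sqsubseteq> x \<longrightarrow> d \<sqsubseteq> y)"
proof
  assume "x \<sqsubseteq> y"
  then show "\<forall>d\<in>Irr L. d \<sqsubseteq> x \<longrightarrow> d \<sqsubseteq> y"
    using x y Irr_in_carrier by (meson le_trans)
next
  assume r: "\<forall>d\<in>Irr L. d \<sqsubseteq> x \<longrightarrow> d \<sqsubseteq> y"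
  obtain A where A: "finite A" "A \<subseteq> Irr L" "A \<subseteq> carrier L" "x = \<Squnion>A"
    using finite_sup_of_Irr[OF x] .
  then have "\<forall>a\<in>A. a \<sqsubseteq> y" using r le_finite_sup[of A] by auto
  then show "x \<sqsubseteq> y" using A y finite_sup_le_iff[of A y] by simp
qed

end


section \<open>Lattice ideals\<close>

lemma carrier_Idl: "carrier (Idl L) = {I. lattice_ideal L I}"
  by (simp add: Idl_def inclusion_order_def)

lemma le_Idl: "I \<sqsubseteq>\<^bsub>Idl L\<^esub> J \<longleftrightarrow> I \<subseteq> J"
  by (simp add: Idl_def inclusion_order_def)

lemma partial_order_inclusion_order: "partial_order (inclusion_order S)"
  by unfold_locales (auto simp: inclusion_order_def)

lemma lattice_ideal_subset: "lattice_ideal L I \<Longrightarrow> I \<subseteq> carrier L"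
  by (simp add: lattice_ideal_def lower_set_def)

lemma lattice_ideal_down:
  "lattice_ideal L I \<Longrightarrow> x \<in> I \<Longrightarrow> y \<in> carrier L \<Longrightarrow> y \<sqsubseteq>\<^bsub>L\<^esub> x \<Longrightarrow> y \<in> I"
  by (auto simp: lattice_ideal_def lower_set_def)

context distributive_lattice
begin

lemma finite_sup_in_ideal_iff:
  assumes I: "lattice_ideal L I" and A: "finite A" "A \<subseteq> carrier L"
  shows "\<Squnion>A \<in> I \<longleftrightarrow> A \<subseteq> I"
proof
  assume "\<Squnion>A \<in> I"
  then show "A \<subseteq> I"
    using A le_finite_sup[OF A] lattice_ideal_down[OF I] by blast
next
  assume "A \<subseteq> I"
  then show "\<Squnion>A \<in> I" using I A by (simp add: lattice_ideal_def)
qed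

lemma lattice_ideal_principal:
  assumes x: "x \<in> carrier L"
  shows "lattice_ideal L (principal L x)"
  unfolding lattice_ideal_def
proof (intro conjI allI impI)
  show "lower_set L (principal L x)"
    using lower_set_principal[OF partial_order_axioms x] .
next
  fix A assume "finite A \<and> A \<subseteq> principal L x"
  then have "finite A" "A \<subseteq> carrier L" "\<forall>a\<in>A. a \<sqsubseteq> x"
    by (auto simp: principal_def)
  then show "\<Squnion>A \<in> principal L x"
    using x finite_sup_le_iff[of A x] finite_sup_in_carrier[of A] by (simp add: principal_def)
qed

lemma principal_subset_ideal_iff:
  "lattice_ideal L I \<Longrightarrow> x \<in> carrier L \<Longrightarrow> principal L x \<subseteq> I \<longleftrightarrow> x \<in> I"
  using lattice_ideal_down[of L I x] by (auto simp: principal_def)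

lemma principal_eq_iff:
  "x \<in> carrier L \<Longrightarrow> y \<in> carrier L \<Longrightarrow> principal L x = principal L y \<longleftrightarrow> x = y"
  using le_antisym[of x y] by (auto simp: principal_def)

lemma lattice_ideal_Inter:
  assumes "\<And>I. I \<in> X \<Longrightarrow> lattice_ideal L I"
  shows "lattice_ideal L (carrier L \<inter> \<Inter>X)"
  unfolding lattice_ideal_def
proof (intro conjI allI impI)
  show "lower_set L (carrier L \<inter> \<Inter>X)"
    using lattice_ideal_down[OF assms] by (auto simp: lower_set_def)
next
  fix A assume A: "finite A \<and> A \<subseteq> carrier L \<inter> \<Inter>X"
  then have "\<Squnion>A \<in> I" if "I \<in> X" for I
    using assms[OF that] that by (auto simp: lattice_ideal_def)
  then show "\<Squnion>A \<in> carrier L \<inter> \<Inter>X"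
    using A finite_sup_in_carrier[of A] by auto
qed

lemma is_glb_Idl_iff:
  assumes X: "X \<subseteq> carrier (Idl L)"
  shows "is_glb (Idl L) S X \<longleftrightarrow> S = carrier L \<inter> \<Inter>X"
proof -
  have I: "lattice_ideal L (carrier L \<inter> \<Inter>X)"
    using X by (intro lattice_ideal_Inter) (auto simp: carrier_Idl)
  then have glb: "is_glb (Idl L) (carrier L \<inter> \<Inter>X) X"
  proof (intro greatest_LowerI)
    fix J assume "J \<in> Lower (Idl L) X"
    then have "lattice_ideal L J" "\<forall>K\<in>X. J \<subseteq> K"
      using X by (auto simp: Lower_def carrier_Idl le_Idl)
    then show "J \<sqsubseteq>\<^bsub>Idl L\<^esub> carrier L \<inter> \<Inter>X"
      using lattice_ideal_subset[of L J] by (simp add: le_Idl Inter_greatest)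
  qed (use X I in \<open>auto simp: carrier_Idl le_Idl\<close>)
  moreover have "S = T" if "is_glb (Idl L) S X" "is_glb (Idl L) T X" for S T
    using that by (auto simp: greatest_def le_Idl)
  ultimately show ?thesis by blast
qed

end


section \<open>The adjoint on join-irreducible elements\<close>

locale irreducibly_generated_hom =
  L: irreducibly_generated_lattice L + M: irreducibly_generated_lattice M
  for L :: "'a gorder" and M :: "'b gorder" +
  fixes f :: "'a \<Rightarrow> 'b"
  assumes hom: "f \<in> dlat_hom L M"
begin

lemma hom_closed: "x \<in> carrier L \<Longrightarrow> f x \<in> carrier M"
  using hom by (auto simp: dlat_hom_def)

lemma hom_finite_sup:
  assumes A: "finite A" "A \<subseteq> carrier L"
  shows "f (\<Squnion>\<^bsub>L\<^esub>A) = \<Squnion>\<^bsub>M\<^esub>(f ` A)"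
proof -
  have "preserves_sup L M f A" using hom A by (simp add: dlat_hom_def)
  then have "least M (f (\<Squnion>\<^bsub>L\<^esub>A)) (Upper M (f ` A))"
    using L.least_finite_sup[OF A] by (simp add: preserves_sup_def)
  then show ?thesis by (rule M.sup_eqI[symmetric])
qed

lemma hom_mono:
  assumes "x \<in> carrier L" "y \<in> carrier L" "x \<sqsubseteq>\<^bsub>L\<^esub> y"
  shows "f x \<sqsubseteq>\<^bsub>M\<^esub> f y"
proof -
  have "\<Squnion>\<^bsub>L\<^esub>{x, y} = y"
    using assms L.le_iff_meet by (simp add: join_def)
  then have "f y = \<Squnion>\<^bsub>M\<^esub>{f x, f y}"
    using hom_finite_sup[of "{x, y}"] assms by simp
  then show ?thesis
    using M.le_finite_sup[of "{f x, f y}" "f x"] assms by (simp add: hom_closed)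
qed

text \<open>The lower closure of \<open>f(I)\<close> is already closed under finite joins, because \<open>f\<close> preserves them;
  so the generated ideal needs no joins.\<close>

lemma ideal_map_eq:
  assumes I: "lattice_ideal L I"
  shows "ideal_map M f I = {y \<in> carrier M. \<exists>x\<in>I. y \<sqsubseteq>\<^bsub>M\<^esub> f x}" (is "_ = ?J")
    and "lattice_ideal M (ideal_map M f I)"
proof -
  have Ic: "I \<subseteq> carrier L" using I by (rule lattice_ideal_subset)
  have J: "lattice_ideal M ?J"
    unfolding lattice_ideal_def
  proof (intro conjI allI impI)
    show "lower_set M ?J"
      unfolding lower_set_def
    proof (intro conjI ballI impI)
      fix y z assume y: "y \<in> ?J" and z: "z \<in> carrier M" "z \<sqsubseteq>\<^bsub>M\<^esub> y"
      from y obtain x where "x \<in> I" "y \<sqsubseteq>\<^bsub>M\<^esub> f x" "y \<in> carrier M" by blast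
      moreover from this have "f x \<in> carrier M" using Ic hom_closed by blast
      ultimately show "z \<in> ?J"
        using z M.le_trans[of z y "f x"] by blast
    qed blast
  next
    fix A assume A: "finite A \<and> A \<subseteq> ?J"
    then have "\<forall>a\<in>A. \<exists>x. x \<in> I \<and> a \<sqsubseteq>\<^bsub>M\<^esub> f x" by blast
    then obtain h where h: "\<forall>a\<in>A. h a \<in> I \<and> a \<sqsubseteq>\<^bsub>M\<^esub> f (h a)" by metis
    have hA: "finite (h ` A)" "h ` A \<subseteq> carrier L" "h ` A \<subseteq> I" using A h Ic by auto
    have s: "\<Squnion>\<^bsub>L\<^esub>(h ` A) \<in> I" "\<Squnion>\<^bsub>L\<^esub>(h ` A) \<in> carrier L"
      using L.finite_sup_in_ideal_iff[OF I hA(1,2)] hA Ic by auto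
    have Ac: "finite A" "A \<subseteq> carrier M" using A by auto
    have "a \<sqsubseteq>\<^bsub>M\<^esub> f (\<Squnion>\<^bsub>L\<^esub>(h ` A))" if a: "a \<in> A" for a
    proof -
      have "f (h a) \<sqsubseteq>\<^bsub>M\<^esub> f (\<Squnion>\<^bsub>L\<^esub>(h ` A))"
        using a hA s by (intro hom_mono L.le_finite_sup) auto
      then show ?thesis
        using h a Ac s hA M.le_trans[of a "f (h a)"] by (meson hom_closed image_subset_iff subset_iff)
    qed
    then have "\<Squnion>\<^bsub>M\<^esub>A \<sqsubseteq>\<^bsub>M\<^esub> f (\<Squnion>\<^bsub>L\<^esub>(h ` A))"
      using M.finite_sup_le_iff[OF Ac] s by (simp add: hom_closed)
    then show "\<Squnion>\<^bsub>M\<^esub>A \<in> ?J"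
      using s M.finite_sup_in_carrier[OF Ac] by blast
  qed
  have sub: "f ` I \<subseteq> ?J" using Ic hom_closed M.le_refl by blast
  have min: "?J \<subseteq> K" if "lattice_ideal M K" "f ` I \<subseteq> K" for K
    using that lattice_ideal_down[of M K] by blast
  show *: "ideal_map M f I = ?J"
    unfolding ideal_map_def generated_ideal_def
  proof (rule subset_antisym)
    show "\<Inter>{K. lattice_ideal M K \<and> f ` I \<subseteq> K} \<subseteq> ?J" using J sub by blast
    show "?J \<subseteq> \<Inter>{K. lattice_ideal M K \<and> f ` I \<subseteq> K}" using min by blast
  qed
  show "lattice_ideal M (ideal_map M f I)" unfolding * by (rule J)
qed

lemma ideal_map_mono:
  "lattice_ideal L I \<Longrightarrow> lattice_ideal L J \<Longrightarrow> I \<subseteq> J \<Longrightarrow> ideal_map M f I \<subseteq> ideal_map M f J"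
  by (auto simp: ideal_map_eq)

lemma preserves_inf_ideal_map_iff:
  assumes X: "X \<subseteq> carrier (Idl L)"
  shows "preserves_inf (Idl L) (Idl M) (ideal_map M f) X \<longleftrightarrow>
    ideal_map M f (carrier L \<inter> \<Inter>X) = carrier M \<inter> \<Inter>(ideal_map M f ` X)"
proof -
  have "ideal_map M f ` X \<subseteq> carrier (Idl M)"
    using X ideal_map_eq(2) by (auto simp: carrier_Idl)
  then show ?thesis
    by (simp add: preserves_inf_def L.is_glb_Idl_iff[OF X] M.is_glb_Idl_iff)
qed

text \<open>If \<open>A(f)\<close> preserves infima, the ideals \<open>I\<close> with \<open>d \<in> A(f)(I)\<close> have a least one, \<open>I\<^sub>0\<close>.
  Some \<open>x \<in> I\<^sub>0\<close> has \<open>d \<sqsubseteq> f x\<close>, and splitting \<open>x\<close> into irreducibles gives an irreducible \<open>a \<in> I\<^sub>0\<close>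
  with \<open>d \<sqsubseteq> f a\<close>, because \<open>d\<close> is join-prime. By minimality \<open>I\<^sub>0\<close> is the principal ideal of \<open>a\<close>.\<close>

lemma ideal_map_preserves_inf_imp_adjoint:
  assumes inf: "\<And>X. X \<subseteq> carrier (Idl L) \<Longrightarrow> preserves_inf (Idl L) (Idl M) (ideal_map M f) X"
    and d: "d \<in> Irr M"
  shows "\<exists>a \<in> Irr L. \<forall>x \<in> carrier L. a \<sqsubseteq>\<^bsub>L\<^esub> x \<longleftrightarrow> d \<sqsubseteq>\<^bsub>M\<^esub> f x"
proof -
  have dc: "d \<in> carrier M" using d by (rule M.Irr_in_carrier)
  define X where "X = {I. lattice_ideal L I \<and> d \<in> ideal_map M f I}"
  define I0 where "I0 = carrier L \<inter> \<Inter>X"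
  have X: "X \<subseteq> carrier (Idl L)" by (auto simp: X_def carrier_Idl)
  have I0: "lattice_ideal L I0"
    unfolding I0_def X_def by (intro L.lattice_ideal_Inter) auto
  have "preserves_inf (Idl L) (Idl M) (ideal_map M f) X" using X by (rule inf)
  then have "ideal_map M f I0 = carrier M \<inter> \<Inter>(ideal_map M f ` X)"
    unfolding preserves_inf_ideal_map_iff[OF X] I0_def .
  then have "d \<in> ideal_map M f I0" using dc by (auto simp: X_def)
  then obtain x where x: "x \<in> I0" "d \<sqsubseteq>\<^bsub>M\<^esub> f x"
    unfolding ideal_map_eq[OF I0] by blast
  have xc: "x \<in> carrier L" using x(1) by (simp add: I0_def)
  obtain A where A: "finite A" "A \<subseteq> Irr L" "A \<subseteq> carrier L" "x = \<Squnion>\<^bsub>L\<^esub>A"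
    using L.finite_sup_of_Irr[OF xc] .
  have "d \<sqsubseteq>\<^bsub>M\<^esub> \<Squnion>\<^bsub>M\<^esub>(f ` A)"
    using x(2) hom_finite_sup[OF A(1,3)] A(4) by simp
  then obtain a where a: "a \<in> A" "d \<sqsubseteq>\<^bsub>M\<^esub> f a"
    using M.Irr_le_finite_sup[OF d, of "f ` A"] A(1) image_subset_iff[of f A] A(3) hom_closed
    by (metis finite_imageI imageE subset_iff)
  have ac: "a \<in> carrier L" "a \<in> Irr L" using a A by auto
  have "a \<in> I0"
    using L.finite_sup_in_ideal_iff[OF I0 A(1,3)] x(1) A(4) a(1) by auto
  have "a \<sqsubseteq>\<^bsub>L\<^esub> y \<longleftrightarrow> d \<sqsubseteq>\<^bsub>M\<^esub> f y" if y: "y \<in> carrier L" for y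
  proof
    assume "a \<sqsubseteq>\<^bsub>L\<^esub> y"
    then show "d \<sqsubseteq>\<^bsub>M\<^esub> f y"
      using hom_mono[OF ac(1) y] a(2) dc ac y M.le_trans hom_closed by meson
  next
    assume "d \<sqsubseteq>\<^bsub>M\<^esub> f y"
    then have "principal L y \<in> X"
      using y dc ideal_map_eq(1)[OF L.lattice_ideal_principal[OF y]] L.le_refl[OF y]
      by (auto simp: X_def L.lattice_ideal_principal) (auto simp: principal_def)
    then have "a \<in> principal L y" using \<open>a \<in> I0\<close> by (auto simp: I0_def)
    then show "a \<sqsubseteq>\<^bsub>L\<^esub> y" by (simp add: principal_def)
  qed
  then show ?thesis using ac by blast
qed

text \<open>An element of all \<open>A(f)(I)\<close> is a join of finitely many irreducibles \<open>d\<close>, and the join of their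
  images under the adjoint lies in every \<open>I\<close>.\<close>

lemma adjoint_imp_ideal_map_preserves_inf:
  assumes adj: "\<And>d. d \<in> Irr M \<Longrightarrow> \<exists>a \<in> carrier L. \<forall>x \<in> carrier L. a \<sqsubseteq>\<^bsub>L\<^esub> x \<longleftrightarrow> d \<sqsubseteq>\<^bsub>M\<^esub> f x"
    and X: "X \<subseteq> carrier (Idl L)"
  shows "preserves_inf (Idl L) (Idl M) (ideal_map M f) X"
proof -
  obtain l where l: "\<And>d. d \<in> Irr M \<Longrightarrow> l d \<in> carrier L"
    "\<And>d x. d \<in> Irr M \<Longrightarrow> x \<in> carrier L \<Longrightarrow> l d \<sqsubseteq>\<^bsub>L\<^esub> x \<longleftrightarrow> d \<sqsubseteq>\<^bsub>M\<^esub> f x"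
    using adj by metis
  have XI: "lattice_ideal L I" if "I \<in> X" for I using X that by (auto simp: carrier_Idl)
  define I0 where "I0 = carrier L \<inter> \<Inter>X"
  have I0: "lattice_ideal L I0"
    unfolding I0_def using XI by (intro L.lattice_ideal_Inter)
  have "y \<in> ideal_map M f I0"
    if y: "y \<in> carrier M" "\<And>I. I \<in> X \<Longrightarrow> y \<in> ideal_map M f I" for y
  proof -
    obtain B where B: "finite B" "B \<subseteq> Irr M" "B \<subseteq> carrier M" "y = \<Squnion>\<^bsub>M\<^esub>B"
      using M.finite_sup_of_Irr[OF y(1)] .
    have lB: "finite (l ` B)" "l ` B \<subseteq> carrier L"
      using B l(1) by auto
    have "l d \<in> I" if "I \<in> X" "d \<in> B" for I d
    proof -
      have I: "lattice_ideal L I" using that XI by blast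
      have "d \<in> ideal_map M f I"
        using M.finite_sup_in_ideal_iff[OF ideal_map_eq(2)[OF I] B(1,3)] y(2)[OF that(1)]
          B(4) that(2) by auto
      then obtain x where x: "x \<in> I" "d \<sqsubseteq>\<^bsub>M\<^esub> f x" by (auto simp: ideal_map_eq[OF I])
      then have "l d \<sqsubseteq>\<^bsub>L\<^esub> x"
        using l(2)[of d x] that(2) B(2) lattice_ideal_subset[OF I] by (meson subset_iff)
      then show ?thesis
        using lattice_ideal_down[OF I x(1), of "l d"] lB(2) that(2) by (simp add: image_subset_iff)
    qed
    then have "l ` B \<subseteq> I0" using lB by (auto simp: I0_def)
    then have s: "\<Squnion>\<^bsub>L\<^esub>(l ` B) \<in> I0" "\<Squnion>\<^bsub>L\<^esub>(l ` B) \<in> carrier L"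
      using L.finite_sup_in_ideal_iff[OF I0 lB] lattice_ideal_subset[OF I0] by auto
    have "d \<sqsubseteq>\<^bsub>M\<^esub> f (\<Squnion>\<^bsub>L\<^esub>(l ` B))" if d: "d \<in> B" for d
      using l(2)[of d "\<Squnion>\<^bsub>L\<^esub>(l ` B)"] d B(2) s L.le_finite_sup[OF lB] by auto
    then have "y \<sqsubseteq>\<^bsub>M\<^esub> f (\<Squnion>\<^bsub>L\<^esub>(l ` B))"
      using M.finite_sup_le_iff[OF B(1,3)] B(4) s hom_closed by auto
    then show ?thesis using s y(1) by (auto simp: ideal_map_eq[OF I0])
  qed
  moreover have "ideal_map M f I0 \<subseteq> ideal_map M f I" if "I \<in> X" for I
    using that ideal_map_mono[OF I0 XI[OF that]] by (auto simp: I0_def)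
  moreover have "ideal_map M f I0 \<subseteq> carrier M"
    using lattice_ideal_subset ideal_map_eq(2)[OF I0] by blast
  ultimately have "ideal_map M f I0 = carrier M \<inter> \<Inter>(ideal_map M f ` X)" by blast
  then show ?thesis
    unfolding preserves_inf_ideal_map_iff[OF X] I0_def .
qed

end

locale irreducibly_generated_arrow = irreducibly_generated_hom +
  assumes ideal_map_preserves_inf:
    "\<And>X. X \<subseteq> carrier (Idl L) \<Longrightarrow> preserves_inf (Idl L) (Idl M) (ideal_map M f) X"
begin

text \<open>The description operator in \<open>left_adjoint\<close> picks out the map sending \<open>J\<close> to the intersection
  of all \<open>I\<close> with \<open>J \<subseteq> A(f)(I)\<close>: it is adjoint to \<open>A(f)\<close> because \<open>A(f)\<close> carries this intersection
  to an ideal that still contains \<open>J\<close>.\<close>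

lemma left_adjoint_ideal_map_subset_iff:
  "lattice_ideal M J \<Longrightarrow> lattice_ideal L I \<Longrightarrow>
     left_adjoint (Idl L) (Idl M) (ideal_map M f) J \<subseteq> I \<longleftrightarrow> J \<subseteq> ideal_map M f I"
  and left_adjoint_ideal_map_closed:
  "lattice_ideal M J \<Longrightarrow> lattice_ideal L (left_adjoint (Idl L) (Idl M) (ideal_map M f) J)"
proof -
  let ?G = "\<lambda>l. \<lparr>orderA = Idl M, orderB = Idl L, lower = l, upper = ideal_map M f\<rparr>"
  define l where
    "l = (\<lambda>J \<in> carrier (Idl M). carrier L \<inter> \<Inter>{I. lattice_ideal L I \<and> J \<subseteq> ideal_map M f I})"
  have l_eq: "l J = carrier L \<inter> \<Inter>{I. lattice_ideal L I \<and> J \<subseteq> ideal_map M f I}"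
    if "lattice_ideal M J" for J
    using that by (simp add: l_def carrier_Idl)
  have closed: "lattice_ideal L (l J)" if "lattice_ideal M J" for J
    unfolding l_eq[OF that] by (intro L.lattice_ideal_Inter) auto
  have adj: "l J \<subseteq> I \<longleftrightarrow> J \<subseteq> ideal_map M f I" if J: "lattice_ideal M J" and I: "lattice_ideal L I" for I J
  proof
    assume "J \<subseteq> ideal_map M f I"
    then show "l J \<subseteq> I" unfolding l_eq[OF J] using I by blast
  next
    assume le: "l J \<subseteq> I"
    let ?X = "{I. lattice_ideal L I \<and> J \<subseteq> ideal_map M f I}"
    have X: "?X \<subseteq> carrier (Idl L)" by (auto simp: carrier_Idl)
    have "ideal_map M f (l J) = carrier M \<inter> \<Inter>(ideal_map M f ` ?X)"
      using ideal_map_preserves_inf[OF X] unfolding preserves_inf_ideal_map_iff[OF X] l_eq[OF J] .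
    then have "J \<subseteq> ideal_map M f (l J)" using lattice_ideal_subset[OF J] by blast
    then show "J \<subseteq> ideal_map M f I" using ideal_map_mono[OF closed[OF J] I le] by blast
  qed
  have po: "partial_order (Idl N)" for N :: "'x gorder"
    by (simp add: Idl_def partial_order_inclusion_order)
  have lc: "l \<in> carrier (Idl M) \<rightarrow>\<^sub>E carrier (Idl L)"
    using closed by (auto simp: carrier_Idl l_def)
  have gal: "galois_connection (?G l)"
    using lc adj ideal_map_eq(2)
    by (intro galois_connection.intro connection.intro galois_connection_axioms.intro)
      (auto simp: po carrier_Idl le_Idl)
  have unique: "l' = l" if "l' \<in> carrier (Idl M) \<rightarrow>\<^sub>E carrier (Idl L)" "galois_connection (?G l')" for l'
  proof (rule extensionalityI[of _ "carrier (Idl M)"])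
    fix J assume J: "J \<in> carrier (Idl M)"
    have l'J: "lattice_ideal L (l' J)" and lJ: "lattice_ideal L (l J)"
      using that(1) lc J by (auto simp: carrier_Idl)
    have "l' J \<subseteq> I \<longleftrightarrow> l J \<subseteq> I" if "lattice_ideal L I" for I
      using galois_connection.galois_property[OF \<open>galois_connection (?G l')\<close>, of J I] J that adj[of J I]
      by (simp add: carrier_Idl le_Idl)
    from this[OF lJ] this[OF l'J] show "l' J = l J" by blast
  qed (use that(1) lc in \<open>auto simp: PiE_def\<close>)
  have eq: "left_adjoint (Idl L) (Idl M) (ideal_map M f) = l"
    unfolding left_adjoint_def using lc gal unique by (intro the_equality) blast+
  show "lattice_ideal M J \<Longrightarrow> lattice_ideal L I \<Longrightarrow>
     left_adjoint (Idl L) (Idl M) (ideal_map M f) J \<subseteq> I \<longleftrightarrow> J \<subseteq> ideal_map M f I"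
    unfolding eq by (rule adj)
  show "lattice_ideal M J \<Longrightarrow> lattice_ideal L (left_adjoint (Idl L) (Idl M) (ideal_map M f) J)"
    unfolding eq by (rule closed)
qed

text \<open>On irreducible elements the left adjoint of \<open>A(f)\<close> is the pointwise left adjoint of \<open>f\<close>;
  everything about the functor \<open>D\<close> follows from this universal property.\<close>

lemma D_map_adjoint:
  assumes d: "d \<in> Irr M"
  shows D_map_in_Irr: "D_map L M f d \<in> Irr L"
    and D_map_le_iff: "\<And>x. x \<in> carrier L \<Longrightarrow> D_map L M f d \<sqsubseteq>\<^bsub>L\<^esub> x \<longleftrightarrow> d \<sqsubseteq>\<^bsub>M\<^esub> f x"
proof -
  have dc: "d \<in> carrier M" using d by (rule M.Irr_in_carrier)
  obtain a where a: "a \<in> Irr L" "\<And>x. x \<in> carrier L \<Longrightarrow> a \<sqsubseteq>\<^bsub>L\<^esub> x \<longleftrightarrow> d \<sqsubseteq>\<^bsub>M\<^esub> f x"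
    using ideal_map_preserves_inf_imp_adjoint[OF ideal_map_preserves_inf d] by blast
  have ac: "a \<in> carrier L" using a(1) by (rule L.Irr_in_carrier)
  let ?J = "left_adjoint (Idl L) (Idl M) (ideal_map M f) (principal M d)"
  have J: "lattice_ideal L ?J"
    using left_adjoint_ideal_map_closed[OF M.lattice_ideal_principal[OF dc]] .
  have "?J \<subseteq> I \<longleftrightarrow> principal L a \<subseteq> I" if I: "lattice_ideal L I" for I
  proof -
    have Ic: "I \<subseteq> carrier L" using I by (rule lattice_ideal_subset)
    have "?J \<subseteq> I \<longleftrightarrow> d \<in> ideal_map M f I"
      using left_adjoint_ideal_map_subset_iff[OF M.lattice_ideal_principal[OF dc] I]
        M.principal_subset_ideal_iff[OF ideal_map_eq(2)[OF I] dc] by simp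
    also have "\<dots> \<longleftrightarrow> (\<exists>x\<in>I. a \<sqsubseteq>\<^bsub>L\<^esub> x)"
    proof -
      have "d \<sqsubseteq>\<^bsub>M\<^esub> f x \<longleftrightarrow> a \<sqsubseteq>\<^bsub>L\<^esub> x" if "x \<in> I" for x
        using a(2) Ic that by blast
      then show ?thesis by (simp add: ideal_map_eq[OF I] dc)
    qed
    also have "\<dots> \<longleftrightarrow> a \<in> I"
      using lattice_ideal_down[OF I _ ac] ac by auto
    also have "\<dots> \<longleftrightarrow> principal L a \<subseteq> I"
      using L.principal_subset_ideal_iff[OF I ac] by simp
    finally show ?thesis .
  qed
  then have "?J = principal L a"
    using J L.lattice_ideal_principal[OF ac] by blast
  then have "D_map L M f d = a"
    using d a(1) ac L.principal_eq_iff L.Irr_in_carrier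
    by (auto simp: D_map_def intro!: the_equality)
  then show "D_map L M f d \<in> Irr L"
    and "\<And>x. x \<in> carrier L \<Longrightarrow> D_map L M f d \<sqsubseteq>\<^bsub>L\<^esub> x \<longleftrightarrow> d \<sqsubseteq>\<^bsub>M\<^esub> f x"
    using a by auto
qed

lemma D_map_eqI:
  assumes d: "d \<in> Irr M" and a: "a \<in> carrier L"
    and le: "\<And>x. x \<in> carrier L \<Longrightarrow> a \<sqsubseteq>\<^bsub>L\<^esub> x \<longleftrightarrow> d \<sqsubseteq>\<^bsub>M\<^esub> f x"
  shows "D_map L M f d = a"
  using D_map_adjoint[OF d] a le L.Irr_in_carrier L.le_refl by (metis L.le_antisym)

end


section \<open>The category of irreducibly generated lattices\<close>

lemma Ob_IrrDLat: "Ob IrrDLat = {L. irreducibly_generated_lattice L}"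
  by (simp add: IrrDLat_def irreducibly_generated_lattice_def irreducibly_generated_lattice_axioms_def)

lemma Hom_IrrDLat_iff:
  assumes "L \<in> Ob IrrDLat" "M \<in> Ob IrrDLat"
  shows "f \<in> Hom IrrDLat L M \<longleftrightarrow> irreducibly_generated_arrow L M f"
  using assms
  by (auto simp: Ob_IrrDLat IrrDLat_def irreducibly_generated_arrow_def
      irreducibly_generated_arrow_axioms_def irreducibly_generated_hom_def
      irreducibly_generated_hom_axioms_def irreducibly_generated_lattice_def
      irreducibly_generated_lattice_axioms_def)

text \<open>In place of the condition on infima of ideals, it is enough to find for each irreducible of the
  target a least element of the source whose image is above it.\<close>

lemma irreducibly_generated_arrowI:
  assumes "irreducibly_generated_lattice L" "irreducibly_generated_lattice M" "f \<in> dlat_hom L M"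
    and "\<And>d. d \<in> Irr M \<Longrightarrow> \<exists>a \<in> carrier L. \<forall>x \<in> carrier L. a \<sqsubseteq>\<^bsub>L\<^esub> x \<longleftrightarrow> d \<sqsubseteq>\<^bsub>M\<^esub> f x"
  shows "irreducibly_generated_arrow L M f"
proof -
  interpret L: irreducibly_generated_lattice L by fact
  interpret M: irreducibly_generated_lattice M by fact
  interpret irreducibly_generated_hom L M f by unfold_locales fact
  show ?thesis
    by unfold_locales (rule adjoint_imp_ideal_map_preserves_inf[OF assms(4)])
qed

lemma irreducibly_generated_arrow_extensional:
  "irreducibly_generated_arrow L M f \<Longrightarrow> f \<in> carrier L \<rightarrow>\<^sub>E carrier M"
  using irreducibly_generated_hom.hom[of L M f]
  by (simp add: irreducibly_generated_arrow_def dlat_hom_def)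

lemma dlat_hom_compose:
  assumes f: "f \<in> dlat_hom L M" and g: "g \<in> dlat_hom M N"
  shows "compose (carrier L) g f \<in> dlat_hom L N"
proof -
  have fc: "f \<in> carrier L \<rightarrow> carrier M" and gc: "g \<in> carrier M \<rightarrow> carrier N"
    using f g by (auto simp: dlat_hom_def)
  have "preserves_sup L N (compose (carrier L) g f) X \<and> preserves_inf L N (compose (carrier L) g f) X"
    if X: "finite X" "X \<subseteq> carrier L" for X
  proof -
    have fX: "finite (f ` X)" "f ` X \<subseteq> carrier M" using X fc by auto
    have "compose (carrier L) g f ` X = g ` f ` X"
      using X by (force simp: compose_def)
    moreover have "preserves_sup L M f X \<and> preserves_inf L M f X"
      using f X by (simp add: dlat_hom_def)
    moreover have "preserves_sup M N g (f ` X) \<and> preserves_inf M N g (f ` X)"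
      using g fX by (simp add: dlat_hom_def)
    ultimately show ?thesis
      by (simp add: preserves_sup_def preserves_inf_def compose_eq)
  qed
  moreover have "compose (carrier L) g f \<in> carrier L \<rightarrow>\<^sub>E carrier N"
    using fc gc by (auto simp: compose_def)
  ultimately show ?thesis by (simp add: dlat_hom_def)
qed

text \<open>Adjoints compose in the reverse order. This gives at once closure of the arrows under
  composition and the functoriality of \<open>D\<close>.\<close>

lemma irreducibly_generated_arrow_compose:
  assumes f: "irreducibly_generated_arrow L M f" and g: "irreducibly_generated_arrow M N g"
  shows "irreducibly_generated_arrow L N (compose (carrier L) g f)"
    and "d \<in> Irr N \<Longrightarrow> D_map L N (compose (carrier L) g f) d = D_map L M f (D_map M N g d)"
proof -
  interpret f: irreducibly_generated_arrow L M f by fact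
  interpret g: irreducibly_generated_arrow M N g by fact
  have adj: "D_map L M f (D_map M N g d) \<sqsubseteq>\<^bsub>L\<^esub> x \<longleftrightarrow> d \<sqsubseteq>\<^bsub>N\<^esub> compose (carrier L) g f x"
    if "d \<in> Irr N" "x \<in> carrier L" for d x
    using that
    by (simp add: compose_eq f.D_map_le_iff g.D_map_le_iff g.D_map_in_Irr f.hom_closed)
  have closed: "D_map L M f (D_map M N g d) \<in> carrier L" if "d \<in> Irr N" for d
    using that by (intro f.L.Irr_in_carrier f.D_map_in_Irr g.D_map_in_Irr)
  show c: "irreducibly_generated_arrow L N (compose (carrier L) g f)"
  proof (rule irreducibly_generated_arrowI)
    show "irreducibly_generated_lattice L" "irreducibly_generated_lattice N"
      by unfold_locales
    show "compose (carrier L) g f \<in> dlat_hom L N"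
      using f.hom g.hom by (rule dlat_hom_compose)
    show "\<exists>a\<in>carrier L. \<forall>x\<in>carrier L. a \<sqsubseteq>\<^bsub>L\<^esub> x \<longleftrightarrow> d \<sqsubseteq>\<^bsub>N\<^esub> compose (carrier L) g f x"
      if "d \<in> Irr N" for d
      using adj[OF that] closed[OF that] by (intro bexI[of _ "D_map L M f (D_map M N g d)"]) auto
  qed
  interpret c: irreducibly_generated_arrow L N "compose (carrier L) g f" by fact
  show "D_map L N (compose (carrier L) g f) d = D_map L M f (D_map M N g d)" if "d \<in> Irr N"
    using that by (intro c.D_map_eqI closed adj)
qed

lemma irreducibly_generated_arrow_order_isomorphism:
  assumes L: "irreducibly_generated_lattice L" and M: "irreducibly_generated_lattice M"
    and h: "order_isomorphism L M h" and ext: "h \<in> extensional (carrier L)"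
  shows "irreducibly_generated_arrow L M h"
proof (rule irreducibly_generated_arrowI[OF L M])
  have M_eq: "carrier M = h ` carrier L"
    and le: "\<And>x y. x \<in> carrier L \<Longrightarrow> y \<in> carrier L \<Longrightarrow> h x \<sqsubseteq>\<^bsub>M\<^esub> h y \<longleftrightarrow> x \<sqsubseteq>\<^bsub>L\<^esub> y"
    using h by (auto simp: order_isomorphism_def bij_betw_def)
  show "h \<in> dlat_hom L M"
    using h ext order_isomorphism_least_Upper[OF h] order_isomorphism_greatest_Lower[OF h]
    by (auto simp: dlat_hom_def preserves_sup_def preserves_inf_def M_eq extensional_def)
  fix d assume "d \<in> Irr M"
  then have "d \<in> h ` carrier L" by (simp add: Irr_def M_eq)
  then show "\<exists>a \<in> carrier L. \<forall>x \<in> carrier L. a \<sqsubseteq>\<^bsub>L\<^esub> x \<longleftrightarrow> d \<sqsubseteq>\<^bsub>M\<^esub> h x"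
    using le by blast
qed

lemma isomorphism_IrrDLat_order_isomorphism:
  assumes L: "L \<in> Ob IrrDLat" and M: "M \<in> Ob IrrDLat"
    and h: "order_isomorphism L M h" and ext: "h \<in> extensional (carrier L)"
  shows "isomorphism IrrDLat L M h"
proof -
  let ?k = "restrict (inv_into (carrier L) h) (carrier M)"
  have "h \<in> Hom IrrDLat L M"
    unfolding Hom_IrrDLat_iff[OF L M] using L M h ext
    by (intro irreducibly_generated_arrow_order_isomorphism) (auto simp: Ob_IrrDLat)
  moreover have "?k \<in> Hom IrrDLat M L"
    unfolding Hom_IrrDLat_iff[OF M L] using L M order_isomorphism_inverse[OF h]
    by (intro irreducibly_generated_arrow_order_isomorphism) (auto simp: Ob_IrrDLat)
  moreover have "Cmp IrrDLat L M L ?k h = Idn IrrDLat L" "Cmp IrrDLat M L M h ?k = Idn IrrDLat M"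
    using order_isomorphism_compose_inverse[OF h ext] by (simp_all add: IrrDLat_def)
  ultimately show ?thesis unfolding isomorphism_def by blast
qed

lemma irreducibly_generated_arrow_identity:
  assumes "irreducibly_generated_lattice L"
  shows "irreducibly_generated_arrow L L (restrict (\<lambda>x. x) (carrier L))"
  using assms
  by (intro irreducibly_generated_arrow_order_isomorphism)
    (auto simp: order_isomorphism_def bij_betw_def inj_on_def)

lemma category_IrrDLat: "category IrrDLat"
proof (rule category.intro)
  show "Idn IrrDLat X \<in> Hom IrrDLat X X" if "X \<in> Ob IrrDLat" for X :: "'a gorder"
    using that irreducibly_generated_arrow_identity[of X] unfolding Hom_IrrDLat_iff[OF that that]
    by (simp add: Ob_IrrDLat) (simp add: IrrDLat_def)
next
  fix X Y Z :: "'a gorder" and f g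
  assume X: "X \<in> Ob IrrDLat" and Y: "Y \<in> Ob IrrDLat" and Z: "Z \<in> Ob IrrDLat"
    and f: "f \<in> Hom IrrDLat X Y" and g: "g \<in> Hom IrrDLat Y Z"
  then show "Cmp IrrDLat X Y Z g f \<in> Hom IrrDLat X Z"
    using irreducibly_generated_arrow_compose(1)
    by (simp add: Hom_IrrDLat_iff) (simp add: IrrDLat_def)
next
  fix X Y :: "'a gorder" and f
  assume X: "X \<in> Ob IrrDLat" and Y: "Y \<in> Ob IrrDLat" and f: "f \<in> Hom IrrDLat X Y"
  then have "f \<in> carrier X \<rightarrow>\<^sub>E carrier Y"
    using irreducibly_generated_arrow_extensional by (simp add: Hom_IrrDLat_iff)
  then show "Cmp IrrDLat X Y Y (Idn IrrDLat Y) f = f" "Cmp IrrDLat X X Y f (Idn IrrDLat X) = f"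
    by (auto simp: IrrDLat_def compose_def fun_eq_iff PiE_def Pi_def extensional_def)
next
  fix W X Y Z :: "'a gorder" and f g h
  assume "W \<in> Ob IrrDLat" "X \<in> Ob IrrDLat" "f \<in> Hom IrrDLat W X"
  then have "f \<in> carrier W \<rightarrow>\<^sub>E carrier X"
    using irreducibly_generated_arrow_extensional by (simp add: Hom_IrrDLat_iff)
  then show "Cmp IrrDLat W Y Z h (Cmp IrrDLat W X Y g f)
      = Cmp IrrDLat W X Z (Cmp IrrDLat X Y Z h g) f"
    by (auto simp: IrrDLat_def compose_def fun_eq_iff PiE_def Pi_def)
qed


section \<open>The category of posets\<close>

locale pos_comp_object = partial_order P for P :: "'a gorder" (structure) +
  assumes finite_meet: "a \<in> carrier P \<Longrightarrow> b \<in> carrier P \<Longrightarrow>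
    \<exists>C. finite C \<and> C \<subseteq> carrier P \<and> (\<forall>p \<in> carrier P. p \<sqsubseteq> a \<and> p \<sqsubseteq> b \<longleftrightarrow> (\<exists>c \<in> C. p \<sqsubseteq> c))"

lemma Ob_Pos_comp: "Ob Pos_comp = {P. pos_comp_object P}"
  by (auto simp: Pos_comp_def pos_comp_object_def pos_comp_object_axioms_def)

locale pos_comp_arrow = P: pos_comp_object P + Q: pos_comp_object Q
  for P :: "'a gorder" and Q :: "'b gorder" +
  fixes g :: "'a \<Rightarrow> 'b"
  assumes extensional: "g \<in> carrier P \<rightarrow>\<^sub>E carrier Q"
    and mono: "p \<in> carrier P \<Longrightarrow> p' \<in> carrier P \<Longrightarrow> p \<sqsubseteq>\<^bsub>P\<^esub> p' \<Longrightarrow> g p \<sqsubseteq>\<^bsub>Q\<^esub> g p'"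
    and preimage_closed: "U \<in> carrier (Id_comp Q) \<Longrightarrow> preimage P g U \<in> carrier (Id_comp P)"
begin

lemma map_closed: "p \<in> carrier P \<Longrightarrow> g p \<in> carrier Q"
  using extensional by auto

end

lemma Hom_Pos_comp_iff:
  assumes "P \<in> Ob Pos_comp" "Q \<in> Ob Pos_comp"
  shows "g \<in> Hom Pos_comp P Q \<longleftrightarrow> pos_comp_arrow P Q g"
proof -
  have "weak_partial_order P" "weak_partial_order Q"
    using assms by (auto simp: Ob_Pos_comp pos_comp_object_def partial_order_def)
  then show ?thesis
    using assms unfolding Ob_Pos_comp
    by (auto simp: Pos_comp_def pos_comp_arrow_def pos_comp_arrow_axioms_def isotone_def)
qed

lemma pos_comp_arrowI:
  assumes P: "pos_comp_object P" and Q: "pos_comp_object Q"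
    and ext: "g \<in> carrier P \<rightarrow>\<^sub>E carrier Q"
    and mono: "\<And>p p'. p \<in> carrier P \<Longrightarrow> p' \<in> carrier P \<Longrightarrow> p \<sqsubseteq>\<^bsub>P\<^esub> p' \<Longrightarrow> g p \<sqsubseteq>\<^bsub>Q\<^esub> g p'"
    and fin: "\<And>q. q \<in> carrier Q \<Longrightarrow> \<exists>A. finite A \<and> A \<subseteq> carrier P \<and>
       (\<forall>p \<in> carrier P. g p \<sqsubseteq>\<^bsub>Q\<^esub> q \<longleftrightarrow> (\<exists>a \<in> A. p \<sqsubseteq>\<^bsub>P\<^esub> a))"
  shows "pos_comp_arrow P Q g"
proof -
  interpret P: pos_comp_object P by fact
  interpret Q: pos_comp_object Q by fact
  have "g \<in> carrier P \<rightarrow> carrier Q" using ext by (simp add: PiE_def)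
  then have "preimage P g ` carrier (Id_comp Q) \<subseteq> carrier (Id_comp P)"
    using preimage_Id_comp_iff[OF P.partial_order_axioms Q.partial_order_axioms] fin by simp
  then show ?thesis using ext mono by unfold_locales auto
qed

lemma pos_comp_arrow_order_isomorphism:
  assumes P: "pos_comp_object P" and Q: "pos_comp_object Q"
    and h: "order_isomorphism P Q h" and ext: "h \<in> extensional (carrier P)"
  shows "pos_comp_arrow P Q h"
proof (rule pos_comp_arrowI[OF P Q])
  have Q_eq: "carrier Q = h ` carrier P"
    and le: "\<And>x y. x \<in> carrier P \<Longrightarrow> y \<in> carrier P \<Longrightarrow> h x \<sqsubseteq>\<^bsub>Q\<^esub> h y \<longleftrightarrow> x \<sqsubseteq>\<^bsub>P\<^esub> y"
    using h by (auto simp: order_isomorphism_def bij_betw_def)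
  show "h \<in> carrier P \<rightarrow>\<^sub>E carrier Q" using ext by (auto simp: Q_eq extensional_def)
  show "h p \<sqsubseteq>\<^bsub>Q\<^esub> h p'" if "p \<in> carrier P" "p' \<in> carrier P" "p \<sqsubseteq>\<^bsub>P\<^esub> p'" for p p'
    using that le by blast
  fix q assume "q \<in> carrier Q"
  then obtain a where "a \<in> carrier P" "q = h a" unfolding Q_eq by blast
  then show "\<exists>A. finite A \<and> A \<subseteq> carrier P \<and>
       (\<forall>p \<in> carrier P. h p \<sqsubseteq>\<^bsub>Q\<^esub> q \<longleftrightarrow> (\<exists>a \<in> A. p \<sqsubseteq>\<^bsub>P\<^esub> a))"
    using le by (intro exI[of _ "{a}"]) auto
qed

lemma isomorphism_Pos_comp_order_isomorphism:
  assumes P: "P \<in> Ob Pos_comp" and Q: "Q \<in> Ob Pos_comp"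
    and h: "order_isomorphism P Q h" and ext: "h \<in> extensional (carrier P)"
  shows "isomorphism Pos_comp P Q h"
proof -
  let ?k = "restrict (inv_into (carrier P) h) (carrier Q)"
  have "h \<in> Hom Pos_comp P Q"
    unfolding Hom_Pos_comp_iff[OF P Q] using P Q h ext
    by (intro pos_comp_arrow_order_isomorphism) (auto simp: Ob_Pos_comp)
  moreover have "?k \<in> Hom Pos_comp Q P"
    unfolding Hom_Pos_comp_iff[OF Q P] using P Q order_isomorphism_inverse[OF h]
    by (intro pos_comp_arrow_order_isomorphism) (auto simp: Ob_Pos_comp)
  moreover have "Cmp Pos_comp P Q P ?k h = Idn Pos_comp P" "Cmp Pos_comp Q P Q h ?k = Idn Pos_comp Q"
    using order_isomorphism_compose_inverse[OF h ext] by (simp_all add: Pos_comp_def)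
  ultimately show ?thesis unfolding isomorphism_def by blast
qed

lemma preimage_compose:
  assumes "f \<in> carrier P \<rightarrow> carrier Q"
  shows "preimage P (compose (carrier P) g f) U = preimage P f (preimage Q g U)"
  using assms by (auto simp: preimage_def compose_def)

lemma pos_comp_arrow_compose:
  assumes "pos_comp_arrow P Q f" and "pos_comp_arrow Q R g"
  shows "pos_comp_arrow P R (compose (carrier P) g f)"
proof -
  interpret f: pos_comp_arrow P Q f by fact
  interpret g: pos_comp_arrow Q R g by fact
  have "f \<in> carrier P \<rightarrow> carrier Q" using f.map_closed by blast
  then have "preimage P (compose (carrier P) g f) U \<in> carrier (Id_comp P)"
    if "U \<in> carrier (Id_comp R)" for U
    using that by (simp add: preimage_compose f.preimage_closed g.preimage_closed)
  moreover have "compose (carrier P) g f \<in> carrier P \<rightarrow>\<^sub>E carrier R"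
    by (simp add: compose_def f.map_closed g.map_closed)
  moreover have "compose (carrier P) g f p \<sqsubseteq>\<^bsub>R\<^esub> compose (carrier P) g f p'"
    if "p \<in> carrier P" "p' \<in> carrier P" "p \<sqsubseteq>\<^bsub>P\<^esub> p'" for p p'
    using that by (simp add: compose_eq f.map_closed g.map_closed f.mono g.mono)
  ultimately show ?thesis
    by (intro pos_comp_arrow.intro pos_comp_arrow_axioms.intro f.P.pos_comp_object_axioms
        g.Q.pos_comp_object_axioms)
qed

lemma category_Pos_comp: "category Pos_comp"
proof (rule category.intro)
  fix X :: "'a gorder" assume X: "X \<in> Ob Pos_comp"
  then have "pos_comp_arrow X X (restrict (\<lambda>x. x) (carrier X))"
    by (intro pos_comp_arrow_order_isomorphism)
      (auto simp: Ob_Pos_comp order_isomorphism_def bij_betw_def inj_on_def)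
  then show "Idn Pos_comp X \<in> Hom Pos_comp X X"
    unfolding Hom_Pos_comp_iff[OF X X] by (simp add: Pos_comp_def)
next
  fix X Y Z :: "'a gorder" and f g
  assume X: "X \<in> Ob Pos_comp" and Y: "Y \<in> Ob Pos_comp" and Z: "Z \<in> Ob Pos_comp"
    and f: "f \<in> Hom Pos_comp X Y" and g: "g \<in> Hom Pos_comp Y Z"
  then show "Cmp Pos_comp X Y Z g f \<in> Hom Pos_comp X Z"
    using pos_comp_arrow_compose
    by (simp add: Hom_Pos_comp_iff) (simp add: Pos_comp_def)
next
  fix X Y :: "'a gorder" and f
  assume X: "X \<in> Ob Pos_comp" and Y: "Y \<in> Ob Pos_comp" and f: "f \<in> Hom Pos_comp X Y"
  then have "f \<in> carrier X \<rightarrow>\<^sub>E carrier Y"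
    by (simp add: Pos_comp_def)
  then show "Cmp Pos_comp X Y Y (Idn Pos_comp Y) f = f" "Cmp Pos_comp X X Y f (Idn Pos_comp X) = f"
    by (auto simp: Pos_comp_def compose_def fun_eq_iff PiE_def Pi_def extensional_def)
next
  fix W X Y Z :: "'a gorder" and f g h
  assume "f \<in> Hom Pos_comp W X"
  then have "f \<in> carrier W \<rightarrow>\<^sub>E carrier X"
    by (simp add: Pos_comp_def)
  then show "Cmp Pos_comp W Y Z h (Cmp Pos_comp W X Y g f)
      = Cmp Pos_comp W X Z (Cmp Pos_comp X Y Z h g) f"
    by (auto simp: Pos_comp_def compose_def fun_eq_iff PiE_def Pi_def)
qed


section \<open>The functor of join-irreducible elements\<close>

context irreducibly_generated_lattice
begin

lemma partial_order_Irr: "partial_order (L\<lparr>carrier := Irr L\<rparr>)"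
proof -
  interpret I: weak_partial_order "L\<lparr>carrier := Irr L\<rparr>"
    by (rule weak_partial_order_subset) (unfold_locales, rule Irr_subset_carrier)
  show ?thesis by unfold_locales (simp add: eq_is_equal)
qed

text \<open>An irreducible is below two given ones iff it is below one of the irreducible parts of their
  meet, because it is join-prime.\<close>

lemma pos_comp_object_Irr: "pos_comp_object (L\<lparr>carrier := Irr L\<rparr>)"
proof -
  interpret I: partial_order "L\<lparr>carrier := Irr L\<rparr>" by (rule partial_order_Irr)
  show ?thesis
  proof unfold_locales
    fix a b assume "a \<in> carrier (L\<lparr>carrier := Irr L\<rparr>)" "b \<in> carrier (L\<lparr>carrier := Irr L\<rparr>)"
    then have ab: "a \<in> carrier L" "b \<in> carrier L" by (auto simp: Irr_in_carrier)
    obtain A where A: "finite A" "A \<subseteq> Irr L" "A \<subseteq> carrier L" "a \<sqinter> b = \<Squnion>A"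
      using finite_sup_of_Irr[OF meet_closed[OF ab]] .
    have "p \<sqsubseteq> a \<and> p \<sqsubseteq> b \<longleftrightarrow> (\<exists>c\<in>A. p \<sqsubseteq> c)" if "p \<in> Irr L" for p
      using le_meet_iff[OF ab Irr_in_carrier[OF that]] Irr_le_finite_sup_iff[OF that A(1,3)] A(4)
      by simp
    then show "\<exists>C. finite C \<and> C \<subseteq> carrier (L\<lparr>carrier := Irr L\<rparr>) \<and>
        (\<forall>p\<in>carrier (L\<lparr>carrier := Irr L\<rparr>).
          p \<sqsubseteq>\<^bsub>L\<lparr>carrier := Irr L\<rparr>\<^esub> a \<and> p \<sqsubseteq>\<^bsub>L\<lparr>carrier := Irr L\<rparr>\<^esub> b \<longleftrightarrow>
          (\<exists>c\<in>C. p \<sqsubseteq>\<^bsub>L\<lparr>carrier := Irr L\<rparr>\<^esub> c))"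
      using A(1,2) by (intro exI[of _ A]) auto
  qed
qed

lemma finitely_covered_Irr:
  assumes "has_top L"
  shows "finitely_covered (L\<lparr>carrier := Irr L\<rparr>)"
proof -
  obtain t where t: "t \<in> carrier L" "\<And>x. x \<in> carrier L \<Longrightarrow> x \<sqsubseteq> t"
    using assms by (auto simp: has_top_def greatest_def)
  obtain A where A: "finite A" "A \<subseteq> Irr L" "A \<subseteq> carrier L" "t = \<Squnion>A"
    using finite_sup_of_Irr[OF t(1)] .
  have "\<exists>a\<in>A. p \<sqsubseteq> a" if "p \<in> Irr L" for p
    using Irr_le_finite_sup[OF that A(1,3)] t(2)[OF Irr_in_carrier[OF that]] A(4) by simp
  then show ?thesis
    unfolding finitely_covered_def using A(1,2) by (intro exI[of _ A]) auto
qed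

end

text \<open>For irreducible \<open>q\<close>, the condition \<open>D(f)(p) \<sqsubseteq> q\<close> means \<open>p \<sqsubseteq> f q\<close>, and this says that \<open>p\<close> is below
  one of the irreducible parts of \<open>f q\<close>: these parts are the finite family required of an arrow.\<close>

lemma (in irreducibly_generated_arrow) pos_comp_arrow_D_map:
  "pos_comp_arrow (M\<lparr>carrier := Irr M\<rparr>) (L\<lparr>carrier := Irr L\<rparr>) (D_map L M f)"
proof (rule pos_comp_arrowI[OF M.pos_comp_object_Irr L.pos_comp_object_Irr])
  show "D_map L M f \<in> carrier (M\<lparr>carrier := Irr M\<rparr>) \<rightarrow>\<^sub>E carrier (L\<lparr>carrier := Irr L\<rparr>)"
    using D_map_in_Irr by (auto simp: D_map_def)
next
  fix d e assume "d \<in> carrier (M\<lparr>carrier := Irr M\<rparr>)" "e \<in> carrier (M\<lparr>carrier := Irr M\<rparr>)"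
    "d \<sqsubseteq>\<^bsub>M\<lparr>carrier := Irr M\<rparr>\<^esub> e"
  then have d: "d \<in> Irr M" and e: "e \<in> Irr M" and le: "d \<sqsubseteq>\<^bsub>M\<^esub> e" by auto
  have De: "D_map L M f e \<in> carrier L" using D_map_in_Irr[OF e] by (rule L.Irr_in_carrier)
  then have "e \<sqsubseteq>\<^bsub>M\<^esub> f (D_map L M f e)" using D_map_le_iff[OF e De] by simp
  then have "d \<sqsubseteq>\<^bsub>M\<^esub> f (D_map L M f e)"
    using le d e De M.Irr_in_carrier hom_closed by (meson M.le_trans)
  then show "D_map L M f d \<sqsubseteq>\<^bsub>L\<lparr>carrier := Irr L\<rparr>\<^esub> D_map L M f e"
    using D_map_le_iff[OF d De] by simp
next
  fix q assume "q \<in> carrier (L\<lparr>carrier := Irr L\<rparr>)"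
  then have q: "q \<in> carrier L" by (simp add: L.Irr_in_carrier)
  obtain A where A: "finite A" "A \<subseteq> Irr M" "A \<subseteq> carrier M" "f q = \<Squnion>\<^bsub>M\<^esub>A"
    using M.finite_sup_of_Irr[OF hom_closed[OF q]] .
  have "D_map L M f p \<sqsubseteq>\<^bsub>L\<^esub> q \<longleftrightarrow> (\<exists>a\<in>A. p \<sqsubseteq>\<^bsub>M\<^esub> a)" if "p \<in> Irr M" for p
    using D_map_le_iff[OF that q] M.Irr_le_finite_sup_iff[OF that A(1,3)] A(4) by simp
  then show "\<exists>A. finite A \<and> A \<subseteq> carrier (M\<lparr>carrier := Irr M\<rparr>) \<and>
      (\<forall>p\<in>carrier (M\<lparr>carrier := Irr M\<rparr>). D_map L M f p \<sqsubseteq>\<^bsub>L\<lparr>carrier := Irr L\<rparr>\<^esub> q \<longleftrightarrow>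
        (\<exists>a\<in>A. p \<sqsubseteq>\<^bsub>M\<lparr>carrier := Irr M\<rparr>\<^esub> a))"
    using A(1,2) by (intro exI[of _ A]) auto
qed

lemma is_functor_D: "is_functor (opposite IrrDLat) Pos_comp D_functor"
proof (rule is_functor.intro)
  fix X :: "'a gorder" assume "X \<in> Ob (opposite IrrDLat)"
  then have X: "irreducibly_generated_lattice X" by (simp add: opposite_def Ob_IrrDLat)
  then show Xob: "Fob D_functor X \<in> Ob Pos_comp"
    by (simp add: D_functor_def Ob_Pos_comp irreducibly_generated_lattice.pos_comp_object_Irr)
  interpret X: irreducibly_generated_arrow X X "restrict (\<lambda>x. x) (carrier X)"
    by (rule irreducibly_generated_arrow_identity[OF X])
  have "D_map X X (restrict (\<lambda>x. x) (carrier X)) = restrict (\<lambda>x. x) (Irr X)"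
  proof (rule extensionalityI[of _ "Irr X"])
    fix d assume "d \<in> Irr X"
    then show "D_map X X (restrict (\<lambda>x. x) (carrier X)) d = restrict (\<lambda>x. x) (Irr X) d"
      by (simp add: X.D_map_eqI X.L.Irr_in_carrier)
  qed (auto simp: D_map_def)
  then show "Fmap D_functor X X (Idn (opposite IrrDLat) X) = Idn Pos_comp (Fob D_functor X)"
    by (simp add: D_functor_def opposite_def IrrDLat_def Pos_comp_def)
next
  fix X Y :: "'a gorder" and f
  assume "X \<in> Ob (opposite IrrDLat)" "Y \<in> Ob (opposite IrrDLat)" "f \<in> Hom (opposite IrrDLat) X Y"
  then have X: "X \<in> Ob IrrDLat" and Y: "Y \<in> Ob IrrDLat" and "f \<in> Hom IrrDLat Y X"
    by (auto simp: opposite_def)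
  then interpret irreducibly_generated_arrow Y X f by (simp add: Hom_IrrDLat_iff)
  have "X\<lparr>carrier := Irr X\<rparr> \<in> Ob Pos_comp" "Y\<lparr>carrier := Irr Y\<rparr> \<in> Ob Pos_comp"
    by (auto simp: Ob_Pos_comp L.pos_comp_object_Irr M.pos_comp_object_Irr)
  then show "Fmap D_functor X Y f \<in> Hom Pos_comp (Fob D_functor X) (Fob D_functor Y)"
    using pos_comp_arrow_D_map by (simp add: D_functor_def Hom_Pos_comp_iff)
next
  fix X Y Z :: "'a gorder" and f g
  assume "X \<in> Ob (opposite IrrDLat)" "Y \<in> Ob (opposite IrrDLat)" "Z \<in> Ob (opposite IrrDLat)"
    "f \<in> Hom (opposite IrrDLat) X Y" "g \<in> Hom (opposite IrrDLat) Y Z"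
  then have f: "irreducibly_generated_arrow Y X f" and g: "irreducibly_generated_arrow Z Y g"
    by (auto simp: opposite_def Hom_IrrDLat_iff)
  have "D_map Z X (compose (carrier Z) f g) = compose (Irr X) (D_map Z Y g) (D_map Y X f)"
    using irreducibly_generated_arrow_compose(2)[OF g f]
    by (intro extensionalityI[of _ "Irr X"]) (auto simp: D_map_def[of Z X] compose_eq)
  then show "Fmap D_functor X Z (Cmp (opposite IrrDLat) X Y Z g f)
    = Cmp Pos_comp (Fob D_functor X) (Fob D_functor Y) (Fob D_functor Z)
        (Fmap D_functor Y Z g) (Fmap D_functor X Y f)"
    by (simp add: D_functor_def opposite_def IrrDLat_def Pos_comp_def)
qed


section \<open>The functor of compact lower sets\<close>

text \<open>Over an infinite universe the compact lower sets of a poset can be coded injectively by elements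
  of the universe.\<close>

locale coded_pos_comp_object = pos_comp_object P for P :: "'u::infinite gorder" (structure)
begin

lemma Id_comp_cases:
  assumes "U \<in> carrier (Id_comp P)"
  obtains A where "finite A" "A \<subseteq> carrier P" "U = (\<Union>a\<in>A. principal P a)"
  using assms unfolding carrier_Id_comp[OF partial_order_axioms] by blast

lemma Id_compI:
  "finite A \<Longrightarrow> A \<subseteq> carrier P \<Longrightarrow> (\<Union>a\<in>A. principal P a) \<in> carrier (Id_comp P)"
  unfolding carrier_Id_comp[OF partial_order_axioms] by blast

lemma Id_comp_principal: "p \<in> carrier P \<Longrightarrow> principal P p \<in> carrier (Id_comp P)"
  using Id_compI[of "{p}"] by simp

lemma Id_comp_subset: "U \<in> carrier (Id_comp P) \<Longrightarrow> U \<subseteq> carrier P"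
  by (elim Id_comp_cases) (auto simp: principal_def)

lemma Id_comp_down:
  assumes U: "U \<in> carrier (Id_comp P)" and q: "q \<in> U" and p: "p \<in> carrier P" "p \<sqsubseteq> q"
  shows "p \<in> U"
proof -
  obtain A where A: "finite A" "A \<subseteq> carrier P" "U = (\<Union>a\<in>A. principal P a)"
    using U by (rule Id_comp_cases)
  then obtain a where "a \<in> A" "a \<in> carrier P" "q \<in> carrier P" "q \<sqsubseteq> a"
    using q by (auto simp: principal_def)
  then show ?thesis using p le_trans[of p q a] A by (auto simp: principal_def)
qed

lemma Id_comp_Union:
  assumes "finite S" "S \<subseteq> carrier (Id_comp P)"
  shows "\<Union>S \<in> carrier (Id_comp P)"
proof -
  have "\<forall>U\<in>S. \<exists>A. finite A \<and> A \<subseteq> carrier P \<and> U = (\<Union>a\<in>A. principal P a)"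
    using assms(2) unfolding carrier_Id_comp[OF partial_order_axioms] by blast
  from bchoice[OF this] obtain h where
    h: "\<forall>U\<in>S. finite (h U) \<and> h U \<subseteq> carrier P \<and> U = (\<Union>a\<in>h U. principal P a)"
    by (rule exE)
  then have "(\<Union>U\<in>S. \<Union>a\<in>h U. principal P a) = \<Union>S" by simp
  then have "\<Union>S = (\<Union>a\<in>(\<Union>U\<in>S. h U). principal P a)" by simp
  moreover have "finite (\<Union>U\<in>S. h U)" "(\<Union>U\<in>S. h U) \<subseteq> carrier P" using h assms(1) by auto
  ultimately show ?thesis using Id_compI[of "\<Union>U\<in>S. h U"] by simp
qed

text \<open>Two principal lower sets meet in a compact one by the condition on objects, and finite unions
  of principal lower sets are met term by term.\<close>

lemma Id_comp_Int:
  assumes U: "U \<in> carrier (Id_comp P)" and V: "V \<in> carrier (Id_comp P)"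
  shows "U \<inter> V \<in> carrier (Id_comp P)"
proof -
  have pp: "principal P a \<inter> principal P b \<in> carrier (Id_comp P)"
    if ab: "a \<in> carrier P" "b \<in> carrier P" for a b
  proof -
    obtain C where "finite C" "C \<subseteq> carrier P"
      "\<forall>p \<in> carrier P. p \<sqsubseteq> a \<and> p \<sqsubseteq> b \<longleftrightarrow> (\<exists>c \<in> C. p \<sqsubseteq> c)"
      using finite_meet[OF ab] by blast
    moreover from this have "principal P a \<inter> principal P b = (\<Union>c\<in>C. principal P c)"
      by (auto simp: principal_def)
    ultimately show ?thesis using Id_compI[of C] by simp
  qed
  obtain A where A: "finite A" "A \<subseteq> carrier P" "U = (\<Union>a\<in>A. principal P a)"
    using U by (rule Id_comp_cases)
  obtain B where B: "finite B" "B \<subseteq> carrier P" "V = (\<Union>b\<in>B. principal P b)"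
    using V by (rule Id_comp_cases)
  have "U \<inter> V = \<Union>((\<lambda>(a, b). principal P a \<inter> principal P b) ` (A \<times> B))"
    unfolding A(3) B(3) by auto
  also have "\<dots> \<in> carrier (Id_comp P)"
    using A(1,2) B(1,2) pp by (intro Id_comp_Union) (auto simp: subset_iff)
  finally show ?thesis .
qed

lemma ideal_code_in: "U \<in> carrier (Id_comp P) \<Longrightarrow> ideal_code P U \<in> carrier (E_ob P)"
  by (simp add: E_ob_def)

lemma ideal_decode_code: "U \<in> carrier (Id_comp P) \<Longrightarrow> ideal_decode P (ideal_code P U) = U"
  unfolding ideal_decode_def by (rule inv_into_f_f[OF inj_on_ideal_code[OF partial_order_axioms]])

lemma ideal_decode_in: "x \<in> carrier (E_ob P) \<Longrightarrow> ideal_decode P x \<in> carrier (Id_comp P)"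
  by (auto simp: E_ob_def ideal_decode_code)

lemma ideal_code_decode: "x \<in> carrier (E_ob P) \<Longrightarrow> ideal_code P (ideal_decode P x) = x"
  by (auto simp: E_ob_def ideal_decode_code)

lemma ideal_decode_subset: "x \<in> carrier (E_ob P) \<Longrightarrow> ideal_decode P x \<subseteq> carrier P"
  using Id_comp_subset ideal_decode_in by blast

lemma ideal_decode_eq_iff:
  "x \<in> carrier (E_ob P) \<Longrightarrow> y \<in> carrier (E_ob P) \<Longrightarrow> ideal_decode P x = ideal_decode P y \<longleftrightarrow> x = y"
  using ideal_code_decode by metis

lemma le_E_ob: "x \<sqsubseteq>\<^bsub>E_ob P\<^esub> y \<longleftrightarrow> ideal_decode P x \<subseteq> ideal_decode P y"
  by (simp add: E_ob_def Id_comp_def inclusion_order_def)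

lemma partial_order_E_ob: "partial_order (E_ob P)"
proof -
  have eq: "x .=\<^bsub>E_ob P\<^esub> y \<longleftrightarrow> x = y" for x y by (simp add: E_ob_def)
  show ?thesis
    using ideal_decode_eq_iff by unfold_locales (auto simp: eq le_E_ob fun_eq_iff)
qed

sublocale E: partial_order "E_ob P" by (rule partial_order_E_ob)

text \<open>The component at \<open>P\<close> of the isomorphism between \<open>P\<close> and \<open>D(E(P))\<close>.\<close>

definition E_unit :: "'u \<Rightarrow> 'u" where
  "E_unit p = ideal_code P (principal P p)"

lemma E_unit_in: "p \<in> carrier P \<Longrightarrow> E_unit p \<in> carrier (E_ob P)"
  by (simp add: E_unit_def ideal_code_in Id_comp_principal)

lemma ideal_decode_E_unit: "p \<in> carrier P \<Longrightarrow> ideal_decode P (E_unit p) = principal P p"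
  by (simp add: E_unit_def ideal_decode_code Id_comp_principal)

lemma E_unit_le_iff:
  assumes "p \<in> carrier P" "x \<in> carrier (E_ob P)"
  shows "E_unit p \<sqsubseteq>\<^bsub>E_ob P\<^esub> x \<longleftrightarrow> p \<in> ideal_decode P x"
  using assms Id_comp_down[OF ideal_decode_in[OF assms(2)]]
  by (auto simp: le_E_ob ideal_decode_E_unit) (auto simp: principal_def)

lemma is_lub_E_ob_iff:
  assumes X: "finite X" "X \<subseteq> carrier (E_ob P)"
  shows "is_lub (E_ob P) s X \<longleftrightarrow> s \<in> carrier (E_ob P) \<and> ideal_decode P s = \<Union>(ideal_decode P ` X)"
proof -
  have lubI: "is_lub (E_ob P) s X"
    if "s \<in> carrier (E_ob P)" "ideal_decode P s = \<Union>(ideal_decode P ` X)" for s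
    using that X by (intro least_UpperI) (auto simp: le_E_ob Upper_def)
  have U: "\<Union>(ideal_decode P ` X) \<in> carrier (Id_comp P)"
    using X ideal_decode_in by (intro Id_comp_Union) auto
  have "is_lub (E_ob P) (ideal_code P (\<Union>(ideal_decode P ` X))) X"
    using U by (intro lubI ideal_code_in ideal_decode_code)
  then have "ideal_decode P s = \<Union>(ideal_decode P ` X)" if "is_lub (E_ob P) s X"
    using E.least_unique[OF that] ideal_decode_code[OF U] by simp
  then show ?thesis using lubI by auto
qed

text \<open>The codes of principal lower sets test membership, so that every infimum that exists in
  \<open>E_ob P\<close>, be it infinite or empty, is an intersection within \<open>P\<close>.\<close>

lemma is_glb_E_ob_iff:
  assumes X: "X \<subseteq> carrier (E_ob P)"
  shows "is_glb (E_ob P) s X \<longleftrightarrow>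
    s \<in> carrier (E_ob P) \<and> ideal_decode P s = carrier P \<inter> \<Inter>(ideal_decode P ` X)"
proof (intro iffI conjI)
  assume "s \<in> carrier (E_ob P) \<and> ideal_decode P s = carrier P \<inter> \<Inter>(ideal_decode P ` X)"
  then show "is_glb (E_ob P) s X"
    using X by (intro greatest_LowerI) (auto simp: le_E_ob Lower_def dest: ideal_decode_subset)
next
  assume s: "is_glb (E_ob P) s X"
  then show sc: "s \<in> carrier (E_ob P)" by simp
  have "p \<in> ideal_decode P s"
    if p: "p \<in> carrier P" "\<And>x. x \<in> X \<Longrightarrow> p \<in> ideal_decode P x" for p
  proof -
    have "E_unit p \<in> Lower (E_ob P) X"
      using p X by (auto simp: Lower_def E_unit_in E_unit_le_iff)
    then have "E_unit p \<sqsubseteq>\<^bsub>E_ob P\<^esub> s" using s by (simp add: greatest_le)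
    then show ?thesis using p sc by (simp add: E_unit_le_iff)
  qed
  moreover have "ideal_decode P s \<subseteq> ideal_decode P x" if "x \<in> X" for x
    using greatest_Lower_below[OF s that X] by (simp add: le_E_ob)
  ultimately show "ideal_decode P s = carrier P \<inter> \<Inter>(ideal_decode P ` X)"
    using ideal_decode_subset[OF sc] by blast
qed

text \<open>\<open>E_ob P\<close> is a copy of a ring of sets, so that its joins and meets are unions and intersections.\<close>

lemma lattice_E_ob: "lattice (E_ob P)"
proof unfold_locales
  fix x y assume xy: "x \<in> carrier (E_ob P)" "y \<in> carrier (E_ob P)"
  have "ideal_decode P x \<union> ideal_decode P y \<in> carrier (Id_comp P)"
    using Id_comp_Union[of "{ideal_decode P x, ideal_decode P y}"] xy ideal_decode_in by simp
  then show "\<exists>s. is_lub (E_ob P) s {x, y}"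
    using xy ideal_code_in ideal_decode_code
    by (intro exI[of _ "ideal_code P (ideal_decode P x \<union> ideal_decode P y)"])
      (simp add: is_lub_E_ob_iff)
  have "ideal_decode P x \<inter> ideal_decode P y \<in> carrier (Id_comp P)"
    using Id_comp_Int xy ideal_decode_in by simp
  moreover have "carrier P \<inter> (ideal_decode P x \<inter> ideal_decode P y) = ideal_decode P x \<inter> ideal_decode P y"
    using ideal_decode_subset[OF xy(1)] by blast
  ultimately show "\<exists>s. is_glb (E_ob P) s {x, y}"
    using xy ideal_code_in ideal_decode_code
    by (intro exI[of _ "ideal_code P (ideal_decode P x \<inter> ideal_decode P y)"])
      (simp add: is_glb_E_ob_iff)
qed

sublocale E: lattice "E_ob P" by (rule lattice_E_ob)

lemma ideal_decode_join:
  assumes "x \<in> carrier (E_ob P)" "y \<in> carrier (E_ob P)"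
  shows "ideal_decode P (x \<squnion>\<^bsub>E_ob P\<^esub> y) = ideal_decode P x \<union> ideal_decode P y"
  using E.sup_of_two_least[OF assms] assms by (simp add: is_lub_E_ob_iff join_def)

lemma ideal_decode_meet:
  assumes "x \<in> carrier (E_ob P)" "y \<in> carrier (E_ob P)"
  shows "ideal_decode P (x \<sqinter>\<^bsub>E_ob P\<^esub> y) = ideal_decode P x \<inter> ideal_decode P y"
  using E.inf_of_two_greatest[OF assms] assms ideal_decode_subset[OF assms(1)]
  by (auto simp: is_glb_E_ob_iff meet_def)

sublocale E: distributive_lattice "E_ob P"
proof unfold_locales
  have "is_lub (E_ob P) (ideal_code P {}) {}"
    using Id_comp_Union[of "{}"] by (simp add: is_lub_E_ob_iff ideal_code_in ideal_decode_code del: Upper_empty)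
  then show "\<exists>b. least (E_ob P) b (carrier (E_ob P))" by auto
next
  fix x y z assume "x \<in> carrier (E_ob P)" "y \<in> carrier (E_ob P)" "z \<in> carrier (E_ob P)"
  then show "x \<sqinter>\<^bsub>E_ob P\<^esub> (y \<squnion>\<^bsub>E_ob P\<^esub> z) = (x \<sqinter>\<^bsub>E_ob P\<^esub> y) \<squnion>\<^bsub>E_ob P\<^esub> (x \<sqinter>\<^bsub>E_ob P\<^esub> z)"
    by (subst ideal_decode_eq_iff[symmetric]) (auto simp: ideal_decode_join ideal_decode_meet)
qed

lemma ideal_decode_finite_sup:
  assumes "finite X" "X \<subseteq> carrier (E_ob P)"
  shows "ideal_decode P (\<Squnion>\<^bsub>E_ob P\<^esub>X) = \<Union>(ideal_decode P ` X)"
  using E.least_finite_sup[OF assms] is_lub_E_ob_iff[OF assms] by blast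

lemma sup_E_unit:
  assumes x: "x \<in> carrier (E_ob P)" and A: "finite A" "A \<subseteq> carrier P"
    and eq: "ideal_decode P x = (\<Union>a\<in>A. principal P a)"
  shows "x = \<Squnion>\<^bsub>E_ob P\<^esub>(E_unit ` A)"
proof -
  have UA: "finite (E_unit ` A)" "E_unit ` A \<subseteq> carrier (E_ob P)" using A E_unit_in by auto
  have "\<Union>(ideal_decode P ` E_unit ` A) = (\<Union>a\<in>A. principal P a)"
    using A(2) by (auto simp: ideal_decode_E_unit subset_iff)
  then have "ideal_decode P x = ideal_decode P (\<Squnion>\<^bsub>E_ob P\<^esub>(E_unit ` A))"
    using eq ideal_decode_finite_sup[OF UA] by simp
  then show ?thesis using x E.finite_sup_in_carrier[OF UA] ideal_decode_eq_iff by blast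
qed

text \<open>An element \<open>p\<close> lies in a union iff it lies in one of the terms, so principal lower sets are
  join-irreducible; and an irreducible finite union of principal lower sets lies in one of them.\<close>

lemma Irr_E_ob: "Irr (E_ob P) = E_unit ` carrier P"
proof (intro subset_antisym subsetI)
  fix x assume "x \<in> E_unit ` carrier P"
  then obtain p where p: "p \<in> carrier P" "x = E_unit p" by blast
  have "ideal_decode P \<bottom>\<^bsub>E_ob P\<^esub> = {}"
    using ideal_decode_finite_sup[of "{}"] by (simp add: E.sup_empty)
  then have "x \<noteq> \<bottom>\<^bsub>E_ob P\<^esub>"
    using p ideal_decode_E_unit[OF p(1)] by (auto simp: principal_def)
  moreover have "a = x \<or> b = x"
    if ab: "a \<in> carrier (E_ob P)" "b \<in> carrier (E_ob P)" and j: "a \<squnion>\<^bsub>E_ob P\<^esub> b = x" for a b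
  proof -
    have "p \<in> ideal_decode P a \<union> ideal_decode P b"
      using ideal_decode_join[OF ab] j p ideal_decode_E_unit[OF p(1)] by (auto simp: principal_def)
    then have "x \<sqsubseteq>\<^bsub>E_ob P\<^esub> a \<or> x \<sqsubseteq>\<^bsub>E_ob P\<^esub> b" using p ab by (auto simp: E_unit_le_iff)
    moreover have "a \<sqsubseteq>\<^bsub>E_ob P\<^esub> x" "b \<sqsubseteq>\<^bsub>E_ob P\<^esub> x" using ab j E.join_left E.join_right by auto
    ultimately show ?thesis using ab p E_unit_in E.le_antisym by blast
  qed
  ultimately show "x \<in> Irr (E_ob P)" using p E_unit_in by (auto simp: Irr_def)
next
  fix x assume x: "x \<in> Irr (E_ob P)"
  then have xc: "x \<in> carrier (E_ob P)" by (rule E.Irr_in_carrier)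
  obtain A where A: "finite A" "A \<subseteq> carrier P" "ideal_decode P x = (\<Union>a\<in>A. principal P a)"
    using Id_comp_cases[OF ideal_decode_in[OF xc]] .
  have UA: "finite (E_unit ` A)" "E_unit ` A \<subseteq> carrier (E_ob P)" using A E_unit_in by auto
  have eq: "x = \<Squnion>\<^bsub>E_ob P\<^esub>(E_unit ` A)" using xc A by (rule sup_E_unit)
  then have "x \<sqsubseteq>\<^bsub>E_ob P\<^esub> \<Squnion>\<^bsub>E_ob P\<^esub>(E_unit ` A)" using xc E.le_refl by simp
  then obtain a where a: "a \<in> A" "x \<sqsubseteq>\<^bsub>E_ob P\<^esub> E_unit a"
    using E.Irr_le_finite_sup[OF x UA] by blast
  moreover have "E_unit a \<sqsubseteq>\<^bsub>E_ob P\<^esub> x"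
    using E.le_finite_sup[OF UA, of "E_unit a"] a(1) eq by simp
  ultimately have "x = E_unit a" using xc UA by (intro E.le_antisym) auto
  then show "x \<in> E_unit ` carrier P" using a A by blast
qed

sublocale E: irreducibly_generated_lattice "E_ob P"
proof unfold_locales
  show "irreducibly_generated (E_ob P)"
    unfolding irreducibly_generated_def
  proof
    fix x assume x: "x \<in> carrier (E_ob P)"
    obtain A where A: "finite A" "A \<subseteq> carrier P" "ideal_decode P x = (\<Union>a\<in>A. principal P a)"
      using Id_comp_cases[OF ideal_decode_in[OF x]] .
    then show "\<exists>B. finite B \<and> B \<subseteq> Irr (E_ob P) \<and> x = \<Squnion>\<^bsub>E_ob P\<^esub>B"
      using sup_E_unit[OF x A] by (intro exI[of _ "E_unit ` A"]) (auto simp: Irr_E_ob)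
  qed
qed

lemma E_unit_order_isomorphism: "order_isomorphism P ((E_ob P)\<lparr>carrier := Irr (E_ob P)\<rparr>) E_unit"
proof -
  have le: "E_unit p \<sqsubseteq>\<^bsub>E_ob P\<^esub> E_unit q \<longleftrightarrow> p \<sqsubseteq> q" if "p \<in> carrier P" "q \<in> carrier P" for p q
    using that by (simp add: E_unit_le_iff E_unit_in ideal_decode_E_unit) (simp add: principal_def)
  then have "inj_on E_unit (carrier P)"
    by (intro inj_onI) (metis E.le_refl E_unit_in le_antisym)
  then show ?thesis using le by (simp add: order_isomorphism_def bij_betw_def Irr_E_ob)
qed

text \<open>The hypothesis says that the whole of \<open>P\<close> is a compact lower set.\<close>

lemma has_top_E_ob:
  assumes "finitely_covered P"
  shows "has_top (E_ob P)"
proof -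
  obtain C where C: "finite C" "C \<subseteq> carrier P" "\<forall>p \<in> carrier P. \<exists>c \<in> C. p \<sqsubseteq> c"
    using assms by (auto simp: finitely_covered_def)
  then have "carrier P = (\<Union>c\<in>C. principal P c)" by (auto simp: principal_def)
  then have "carrier P \<in> carrier (Id_comp P)" using Id_compI[OF C(1,2)] by simp
  then have "greatest (E_ob P) (ideal_code P (carrier P)) (carrier (E_ob P))"
    using is_glb_E_ob_iff[of "{}"] ideal_code_in ideal_decode_code by simp
  then show ?thesis by (auto simp: has_top_def)
qed

end

locale coded_pos_comp_arrow = pos_comp_arrow P Q g +
  P: coded_pos_comp_object P + Q: coded_pos_comp_object Q
  for P Q :: "'u::infinite gorder" and g :: "'u \<Rightarrow> 'u"
begin

lemma E_map_in: "x \<in> carrier (E_ob Q) \<Longrightarrow> E_map P Q g x \<in> carrier (E_ob P)"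
  by (simp add: E_map_def P.ideal_code_in preimage_closed Q.ideal_decode_in)

lemma ideal_decode_E_map:
  "x \<in> carrier (E_ob Q) \<Longrightarrow> ideal_decode P (E_map P Q g x) = preimage P g (ideal_decode Q x)"
  by (simp add: E_map_def P.ideal_decode_code preimage_closed Q.ideal_decode_in)

text \<open>Preimages preserve unions and intersections, and this includes the empty intersection, that
  is, the top element if there is one.\<close>

lemma E_map_dlat_hom: "E_map P Q g \<in> dlat_hom (E_ob Q) (E_ob P)"
proof -
  have "preserves_sup (E_ob Q) (E_ob P) (E_map P Q g) X" "preserves_inf (E_ob Q) (E_ob P) (E_map P Q g) X"
    if X: "finite X" "X \<subseteq> carrier (E_ob Q)" for X
  proof -
    have EX: "finite (E_map P Q g ` X)" "E_map P Q g ` X \<subseteq> carrier (E_ob P)"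
      using X E_map_in by auto
    have dX: "ideal_decode P ` E_map P Q g ` X = preimage P g ` ideal_decode Q ` X"
      unfolding image_image using X(2) by (intro image_cong refl ideal_decode_E_map) blast
    have "preimage P g (\<Union>(ideal_decode Q ` X)) = \<Union>(preimage P g ` ideal_decode Q ` X)"
      by (auto simp: preimage_def)
    then show "preserves_sup (E_ob Q) (E_ob P) (E_map P Q g) X"
      unfolding preserves_sup_def Q.is_lub_E_ob_iff[OF X] P.is_lub_E_ob_iff[OF EX] dX
      by (simp add: E_map_in ideal_decode_E_map)
    have "preimage P g (carrier Q \<inter> \<Inter>(ideal_decode Q ` X))
        = carrier P \<inter> \<Inter>(preimage P g ` ideal_decode Q ` X)"
      by (auto simp: preimage_def map_closed)
    then show "preserves_inf (E_ob Q) (E_ob P) (E_map P Q g) X"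
      unfolding preserves_inf_def Q.is_glb_E_ob_iff[OF X(2)] P.is_glb_E_ob_iff[OF EX(2)] dX
      by (simp add: E_map_in ideal_decode_E_map)
  qed
  moreover have "E_map P Q g \<in> carrier (E_ob Q) \<rightarrow>\<^sub>E carrier (E_ob P)"
    using E_map_in by (auto simp: E_map_def)
  ultimately show ?thesis by (simp add: dlat_hom_def)
qed

text \<open>Both sides say that \<open>g p\<close> lies in the set coded by \<open>x\<close>. Hence \<open>E(g)\<close> has an adjoint on
  irreducibles, namely \<open>g\<close> itself up to coding; it makes \<open>E(g)\<close> an arrow, and it is \<open>D(E(g))\<close>.\<close>

lemma E_unit_le_E_map_iff:
  "p \<in> carrier P \<Longrightarrow> x \<in> carrier (E_ob Q) \<Longrightarrow>
     Q.E_unit (g p) \<sqsubseteq>\<^bsub>E_ob Q\<^esub> x \<longleftrightarrow> P.E_unit p \<sqsubseteq>\<^bsub>E_ob P\<^esub> E_map P Q g x"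
  by (simp add: Q.E_unit_le_iff P.E_unit_le_iff map_closed E_map_in ideal_decode_E_map preimage_def)

lemma irreducibly_generated_arrow_E_map:
  "irreducibly_generated_arrow (E_ob Q) (E_ob P) (E_map P Q g)"
proof (rule irreducibly_generated_arrowI)
  show "irreducibly_generated_lattice (E_ob Q)" "irreducibly_generated_lattice (E_ob P)"
    by unfold_locales
  show "E_map P Q g \<in> dlat_hom (E_ob Q) (E_ob P)" by (rule E_map_dlat_hom)
  fix d assume "d \<in> Irr (E_ob P)"
  then obtain p where p: "p \<in> carrier P" "d = P.E_unit p" by (auto simp: P.Irr_E_ob)
  then show "\<exists>a\<in>carrier (E_ob Q). \<forall>x\<in>carrier (E_ob Q).
      a \<sqsubseteq>\<^bsub>E_ob Q\<^esub> x \<longleftrightarrow> d \<sqsubseteq>\<^bsub>E_ob P\<^esub> E_map P Q g x"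
    using E_unit_le_E_map_iff map_closed Q.E_unit_in by (intro bexI[of _ "Q.E_unit (g p)"]) auto
qed

lemma D_map_E_map:
  assumes p: "p \<in> carrier P"
  shows "D_map (E_ob Q) (E_ob P) (E_map P Q g) (P.E_unit p) = Q.E_unit (g p)"
proof -
  interpret E: irreducibly_generated_arrow "E_ob Q" "E_ob P" "E_map P Q g"
    by (rule irreducibly_generated_arrow_E_map)
  show ?thesis
    using p by (intro E.D_map_eqI Q.E_unit_in map_closed E_unit_le_E_map_iff)
      (auto simp: P.Irr_E_ob)
qed

end

lemma coded_pos_comp_arrowI:
  fixes P Q :: "'u::infinite gorder"
  assumes "P \<in> Ob Pos_comp" "Q \<in> Ob Pos_comp" "g \<in> Hom Pos_comp P Q"
  shows "coded_pos_comp_arrow P Q g"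
  using assms
  by (simp add: Hom_Pos_comp_iff coded_pos_comp_arrow_def coded_pos_comp_object_def Ob_Pos_comp)

lemma is_functor_E:
  "is_functor Pos_comp (opposite IrrDLat) (E_functor :: ('u::infinite gorder, _, _, _) fctr)"
proof (rule is_functor.intro)
  fix P :: "'u gorder" assume P: "P \<in> Ob Pos_comp"
  then interpret coded_pos_comp_object P by (simp add: Ob_Pos_comp coded_pos_comp_object_def)
  show "Fob E_functor P \<in> Ob (opposite IrrDLat)"
    using E.irreducibly_generated_lattice_axioms by (simp add: E_functor_def opposite_def Ob_IrrDLat)
  have "preimage P (restrict (\<lambda>x. x) (carrier P)) (ideal_decode P x) = ideal_decode P x"
    if "x \<in> carrier (E_ob P)" for x
    using ideal_decode_subset[OF that] by (auto simp: preimage_def)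
  then have "E_map P P (restrict (\<lambda>x. x) (carrier P)) = restrict (\<lambda>x. x) (carrier (E_ob P))"
    by (auto simp: E_map_def ideal_code_decode intro!: restrict_ext)
  then show "Fmap E_functor P P (Idn Pos_comp P) = Idn (opposite IrrDLat) (Fob E_functor P)"
    by (simp add: E_functor_def opposite_def IrrDLat_def Pos_comp_def)
next
  fix P Q :: "'u gorder" and g
  assume "P \<in> Ob Pos_comp" "Q \<in> Ob Pos_comp" "g \<in> Hom Pos_comp P Q"
  then interpret coded_pos_comp_arrow P Q g by (rule coded_pos_comp_arrowI)
  have "E_ob P \<in> Ob IrrDLat" "E_ob Q \<in> Ob IrrDLat"
    using P.E.irreducibly_generated_lattice_axioms Q.E.irreducibly_generated_lattice_axioms
    by (auto simp: Ob_IrrDLat)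
  then show "Fmap E_functor P Q g \<in> Hom (opposite IrrDLat) (Fob E_functor P) (Fob E_functor Q)"
    using irreducibly_generated_arrow_E_map by (simp add: E_functor_def opposite_def Hom_IrrDLat_iff)
next
  fix P Q R :: "'u gorder" and f g
  assume *: "P \<in> Ob Pos_comp" "Q \<in> Ob Pos_comp" "R \<in> Ob Pos_comp"
    "f \<in> Hom Pos_comp P Q" "g \<in> Hom Pos_comp Q R"
  interpret f: coded_pos_comp_arrow P Q f using *(1,2,4) by (rule coded_pos_comp_arrowI)
  interpret g: coded_pos_comp_arrow Q R g using *(2,3,5) by (rule coded_pos_comp_arrowI)
  have "f \<in> carrier P \<rightarrow> carrier Q" using f.map_closed by blast
  then have "E_map P R (compose (carrier P) g f) = compose (carrier (E_ob R)) (E_map P Q f) (E_map Q R g)"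
    by (auto simp: E_map_def[of P] compose_def g.ideal_decode_E_map g.E_map_in
        preimage_compose[unfolded compose_def] intro!: restrict_ext)
  then show "Fmap E_functor P R (Cmp Pos_comp P Q R g f)
    = Cmp (opposite IrrDLat) (Fob E_functor P) (Fob E_functor Q) (Fob E_functor R)
        (Fmap E_functor Q R g) (Fmap E_functor P Q f)"
    by (simp add: E_functor_def opposite_def IrrDLat_def Pos_comp_def)
qed


section \<open>The natural isomorphisms\<close>

text \<open>The component at \<open>L\<close> of the isomorphism between \<open>L\<close> and \<open>E(D(L))\<close>.\<close>

definition irreducibles_below :: "'u gorder \<Rightarrow> 'u \<Rightarrow> 'u" where
  "irreducibles_below L =
     (\<lambda>x \<in> carrier L. ideal_code (L\<lparr>carrier := Irr L\<rparr>) {d \<in> Irr L. d \<sqsubseteq>\<^bsub>L\<^esub> x})"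

locale coded_irreducibly_generated_lattice = irreducibly_generated_lattice L
  for L :: "'u::infinite gorder" (structure)
begin

sublocale D: coded_pos_comp_object "L\<lparr>carrier := Irr L\<rparr>"
  using pos_comp_object_Irr by (simp add: coded_pos_comp_object_def)

lemma irreducibles_below_compact:
  assumes x: "x \<in> carrier L"
  shows "{d \<in> Irr L. d \<sqsubseteq> x} \<in> carrier (Id_comp (L\<lparr>carrier := Irr L\<rparr>))"
proof -
  obtain A where A: "finite A" "A \<subseteq> Irr L" "A \<subseteq> carrier L" "x = \<Squnion>A"
    using finite_sup_of_Irr[OF x] .
  have "{d \<in> Irr L. d \<sqsubseteq> x} = (\<Union>a\<in>A. principal (L\<lparr>carrier := Irr L\<rparr>) a)"
    using Irr_le_finite_sup_iff[OF _ A(1,3)] A(4) by (auto simp: principal_def)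
  then show ?thesis using D.Id_compI[of A] A by simp
qed

lemma irreducibles_below_in:
  "x \<in> carrier L \<Longrightarrow> irreducibles_below L x \<in> carrier (E_ob (L\<lparr>carrier := Irr L\<rparr>))"
  by (simp add: irreducibles_below_def D.ideal_code_in irreducibles_below_compact)

lemma ideal_decode_irreducibles_below:
  "x \<in> carrier L \<Longrightarrow>
     ideal_decode (L\<lparr>carrier := Irr L\<rparr>) (irreducibles_below L x) = {d \<in> Irr L. d \<sqsubseteq> x}"
  by (simp add: irreducibles_below_def D.ideal_decode_code irreducibles_below_compact)

text \<open>The order is reflected because every element is the join of the irreducibles below it. A compact
  lower set generated by a finite set \<open>A\<close> of irreducibles is reached from the join of \<open>A\<close>: an
  irreducible below this join is below some element of \<open>A\<close>.\<close>

lemma irreducibles_below_order_isomorphism: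
  "order_isomorphism L (E_ob (L\<lparr>carrier := Irr L\<rparr>)) (irreducibles_below L)"
proof -
  have le: "irreducibles_below L x \<sqsubseteq>\<^bsub>E_ob (L\<lparr>carrier := Irr L\<rparr>)\<^esub> irreducibles_below L y \<longleftrightarrow> x \<sqsubseteq> y"
    if "x \<in> carrier L" "y \<in> carrier L" for x y
    using that le_iff_Irr by (auto simp: D.le_E_ob ideal_decode_irreducibles_below)
  have "inj_on (irreducibles_below L) (carrier L)"
  proof (rule inj_onI)
    fix x y assume "x \<in> carrier L" "y \<in> carrier L" "irreducibles_below L x = irreducibles_below L y"
    then show "x = y"
      using le[of x y] le[of y x] irreducibles_below_in D.E.le_refl by (intro le_antisym) auto
  qed
  moreover have "u \<in> irreducibles_below L ` carrier L"
    if u: "u \<in> carrier (E_ob (L\<lparr>carrier := Irr L\<rparr>))" for u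
  proof -
    obtain A where A: "finite A" "A \<subseteq> carrier (L\<lparr>carrier := Irr L\<rparr>)"
      "ideal_decode (L\<lparr>carrier := Irr L\<rparr>) u = (\<Union>a\<in>A. principal (L\<lparr>carrier := Irr L\<rparr>) a)"
      using D.Id_comp_cases[OF D.ideal_decode_in[OF u]] .
    have Ac: "A \<subseteq> carrier L" using A(2) Irr_subset_carrier by auto
    have s: "\<Squnion>A \<in> carrier L" using A(1) Ac by (rule finite_sup_in_carrier)
    have "ideal_decode (L\<lparr>carrier := Irr L\<rparr>) u = {d \<in> Irr L. d \<sqsubseteq> \<Squnion>A}"
      using Irr_le_finite_sup_iff[OF _ A(1) Ac] A(3) by (auto simp: principal_def)
    then have "u = irreducibles_below L (\<Squnion>A)"
      using D.ideal_decode_eq_iff[OF u irreducibles_below_in[OF s]] s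
      by (simp add: ideal_decode_irreducibles_below)
    then show ?thesis using s by blast
  qed
  ultimately show ?thesis
    using le irreducibles_below_in by (auto simp: order_isomorphism_def bij_betw_def)
qed

end

text \<open>Naturality says that \<open>{d. D(f)(d) \<sqsubseteq> x} = {d. d \<sqsubseteq> f x}\<close>, which is the adjunction.\<close>

lemma naturally_isomorphic_ED:
  "naturally_isomorphic (opposite IrrDLat) (opposite IrrDLat)
     (compose_functors (E_functor :: ('u::infinite gorder, _, _, _) fctr) D_functor) identity_functor"
  unfolding naturally_isomorphic_def
proof (intro exI[of _ irreducibles_below] conjI ballI)
  fix L :: "'u gorder" assume "L \<in> Ob (opposite IrrDLat)"
  then have L: "L \<in> Ob IrrDLat" by (simp add: opposite_def)
  then interpret coded_irreducibly_generated_lattice L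
    by (simp add: Ob_IrrDLat coded_irreducibly_generated_lattice_def)
  have "E_ob (L\<lparr>carrier := Irr L\<rparr>) \<in> Ob IrrDLat"
    using D.E.irreducibly_generated_lattice_axioms by (simp add: Ob_IrrDLat)
  from isomorphism_IrrDLat_order_isomorphism[OF L this irreducibles_below_order_isomorphism]
  show "isomorphism (opposite IrrDLat) (Fob (compose_functors E_functor D_functor) L)
      (Fob identity_functor L) (irreducibles_below L)"
    by (simp add: isomorphism_opposite compose_functors_def D_functor_def E_functor_def
        identity_functor_def irreducibles_below_def)
next
  fix M L :: "'u gorder" and f
  assume "M \<in> Ob (opposite IrrDLat)" "L \<in> Ob (opposite IrrDLat)" "f \<in> Hom (opposite IrrDLat) M L"
  then have f: "irreducibly_generated_arrow L M f"
    and lat: "irreducibly_generated_lattice L" "irreducibly_generated_lattice M"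
    by (auto simp: opposite_def Hom_IrrDLat_iff Ob_IrrDLat)
  interpret f: irreducibly_generated_arrow L M f by fact
  interpret L: coded_irreducibly_generated_lattice L
    using lat by (simp add: coded_irreducibly_generated_lattice_def)
  interpret M: coded_irreducibly_generated_lattice M
    using lat by (simp add: coded_irreducibly_generated_lattice_def)
  interpret Df: coded_pos_comp_arrow "M\<lparr>carrier := Irr M\<rparr>" "L\<lparr>carrier := Irr L\<rparr>" "D_map L M f"
    using f.pos_comp_arrow_D_map M.D.coded_pos_comp_object_axioms L.D.coded_pos_comp_object_axioms
    by (simp add: coded_pos_comp_arrow_def)
  have "E_map (M\<lparr>carrier := Irr M\<rparr>) (L\<lparr>carrier := Irr L\<rparr>) (D_map L M f) (irreducibles_below L x)
      = irreducibles_below M (f x)" if x: "x \<in> carrier L" for x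
  proof -
    have "preimage (M\<lparr>carrier := Irr M\<rparr>) (D_map L M f) {d \<in> Irr L. d \<sqsubseteq>\<^bsub>L\<^esub> x} = {d \<in> Irr M. d \<sqsubseteq>\<^bsub>M\<^esub> f x}"
      using f.D_map_in_Irr f.D_map_le_iff[OF _ x] by (auto simp: preimage_def)
    then show ?thesis
      using x by (simp add: E_map_def L.irreducibles_below_in L.ideal_decode_irreducibles_below)
        (simp add: irreducibles_below_def f.hom_closed)
  qed
  then have "compose (carrier L) (E_map (M\<lparr>carrier := Irr M\<rparr>) (L\<lparr>carrier := Irr L\<rparr>) (D_map L M f))
      (irreducibles_below L) = compose (carrier L) (irreducibles_below M) f"
    by (auto simp: compose_def intro!: restrict_ext)
  then show "Cmp (opposite IrrDLat) (Fob (compose_functors E_functor D_functor) M)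
        (Fob (compose_functors E_functor D_functor) L) (Fob identity_functor L)
        (irreducibles_below L) (Fmap (compose_functors E_functor D_functor) M L f)
      = Cmp (opposite IrrDLat) (Fob (compose_functors E_functor D_functor) M)
        (Fob identity_functor M) (Fob identity_functor L)
        (Fmap identity_functor M L f) (irreducibles_below M)"
    by (simp add: opposite_def IrrDLat_def compose_functors_def D_functor_def E_functor_def
        identity_functor_def)
qed

text \<open>The components are the inverses of the isomorphisms sending \<open>p\<close> to the code of its principal
  lower set; naturality is the formula \<open>D_map_E_map\<close>.\<close>

lemma naturally_isomorphic_DE:
  "naturally_isomorphic Pos_comp Pos_comp
     (compose_functors D_functor (E_functor :: ('u::infinite gorder, _, _, _) fctr)) identity_functor"
  unfolding naturally_isomorphic_def
proof (intro exI[of _ "\<lambda>P. restrict (inv_into (carrier P) (coded_pos_comp_object.E_unit P)) (Irr (E_ob P))"]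
    conjI ballI)
  fix P :: "'u gorder" assume P: "P \<in> Ob Pos_comp"
  then interpret coded_pos_comp_object P by (simp add: Ob_Pos_comp coded_pos_comp_object_def)
  have "(E_ob P)\<lparr>carrier := Irr (E_ob P)\<rparr> \<in> Ob Pos_comp"
    using E.pos_comp_object_Irr by (simp add: Ob_Pos_comp)
  from isomorphism_Pos_comp_order_isomorphism[OF this P
      order_isomorphism_inverse[OF E_unit_order_isomorphism]]
  show "isomorphism Pos_comp (Fob (compose_functors D_functor E_functor) P) (Fob identity_functor P)
      (restrict (inv_into (carrier P) E_unit) (Irr (E_ob P)))"
    by (simp add: compose_functors_def D_functor_def E_functor_def identity_functor_def)
next
  fix P Q :: "'u gorder" and g
  assume "P \<in> Ob Pos_comp" "Q \<in> Ob Pos_comp" "g \<in> Hom Pos_comp P Q"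
  then interpret coded_pos_comp_arrow P Q g by (rule coded_pos_comp_arrowI)
  have inv_P: "inv_into (carrier P) P.E_unit (P.E_unit p) = p" if "p \<in> carrier P" for p
    using P.E_unit_order_isomorphism that by (auto simp: order_isomorphism_def bij_betw_def)
  have inv_Q: "inv_into (carrier Q) Q.E_unit (Q.E_unit q) = q" if "q \<in> carrier Q" for q
    using Q.E_unit_order_isomorphism that by (auto simp: order_isomorphism_def bij_betw_def)
  have "compose (Irr (E_ob P)) (restrict (inv_into (carrier Q) Q.E_unit) (Irr (E_ob Q)))
      (D_map (E_ob Q) (E_ob P) (E_map P Q g))
    = compose (Irr (E_ob P)) g (restrict (inv_into (carrier P) P.E_unit) (Irr (E_ob P)))"
    by (auto simp: compose_def P.Irr_E_ob Q.Irr_E_ob D_map_E_map inv_P inv_Q map_closed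
        intro!: restrict_ext)
  then show "Cmp Pos_comp (Fob (compose_functors D_functor E_functor) P)
        (Fob (compose_functors D_functor E_functor) Q) (Fob identity_functor Q)
        (restrict (inv_into (carrier Q) Q.E_unit) (Irr (E_ob Q)))
        (Fmap (compose_functors D_functor E_functor) P Q g)
      = Cmp Pos_comp (Fob (compose_functors D_functor E_functor) P)
        (Fob identity_functor P) (Fob identity_functor Q)
        (Fmap identity_functor P Q g) (restrict (inv_into (carrier P) P.E_unit) (Irr (E_ob P)))"
    by (simp add: Pos_comp_def compose_functors_def D_functor_def E_functor_def identity_functor_def)
qed


section \<open>The duality\<close>

theorem theorem5p6:
  shows "dual_via (IrrDLat :: ('u::infinite gorder, 'u \<Rightarrow> 'u) cat) Pos_comp D_functor E_functor
    \<and> dual_via (full_subcategory (IrrDLat :: ('u gorder, 'u \<Rightarrow> 'u) cat) has_top)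
               (full_subcategory Pos_comp finitely_covered) D_functor E_functor"
proof
  show dual: "dual_via (IrrDLat :: ('u gorder, 'u \<Rightarrow> 'u) cat) Pos_comp D_functor E_functor"
    unfolding dual_via_def equivalence_via_def
    using category_IrrDLat category_opposite[OF category_IrrDLat] category_Pos_comp
      is_functor_D is_functor_E naturally_isomorphic_ED naturally_isomorphic_DE by blast
  show "dual_via (full_subcategory (IrrDLat :: ('u gorder, 'u \<Rightarrow> 'u) cat) has_top)
               (full_subcategory Pos_comp finitely_covered) D_functor E_functor"
  proof (rule dual_via_full_subcategory[OF dual])
    fix L :: "'u gorder" assume "L \<in> Ob IrrDLat" "has_top L"
    then show "finitely_covered (Fob D_functor L)"
      by (simp add: D_functor_def Ob_IrrDLat irreducibly_generated_lattice.finitely_covered_Irr)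
  next
    fix P :: "'u gorder" assume "P \<in> Ob Pos_comp" "finitely_covered P"
    then show "has_top (Fob E_functor P)"
      by (simp add: E_functor_def Ob_Pos_comp coded_pos_comp_object_def
          coded_pos_comp_object.has_top_E_ob)
  qed
qed

end
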